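(* Let $K\in C^1_b(\mathbb{R}^d\times\mathbb{R}^d)$ be a real symmetric strictly positive definite kernel on $\mathbb{R}^d$. Suppose that $K(x,y)=\Phi(x-y)$, $x,y\in\mathbb{R}^d$, for some continuous and integrable function $\Phi$ on $\mathbb{R}^d$ whose Fourier transform $\widehat\Phi$ is also integrable on $\mathbb{R}^d$ and satisfies $\widehat\Phi(\xi)>0$ for every $\xi\in\mathbb{R}^d$. Then $\gamma_K$ is a metric on $\mathcal{P}(\mathbb{R}^d)$ that metrizes the weak topology (the topology of weak convergence of probability measures).
   Context: $\mathcal{P}(\mathbb{R}^d)$ is the set of Borel probability measures on $\mathbb{R}^d$. $C^1_b(A)$ is the space of functions on $A$ having bounded and continuous derivatives up to order $1$. The kernel $K$ is symmetric and strictly positive definite if $K(x,y)=K(y,x)$ for all $x,y$, and $\sum_{j,\ell=1}^N\alpha_j\alpha_\ell K(x_j,x_\ell)>0$ for all pairwise distinct $x_1,\dots,x_N\in\mathbb{R}^d$ and all $\alpha\in\mathbb{R}^N\setminus\{0\}$. Let $\mathcal{H}\subset C(\mathbb{R}^d)$ be the unique Hilbert space with reproducing kernel $K$, with norm $\|\cdot\|$. The maximum mean discrepancy is $$\gamma_K(\mu,\nu)=\sup_{f\in\mathcal{H},\,\|f\|\le1}\Big|\int_{\mathbb{R}^d}f\,d\mu-\int_{\mathbb{R}^d}f\,d\nu\Big|,\qquad\mu,\nu\in\mathcal{P}(\mathbb{R}^d).$$ The Fourier transform is $\widehat\Phi(\xi)=(2\pi)^{-d/2}\int_{\mathbb{R}^d}\Phi(x)e^{-i\xi^{\mathsf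 T}x}dx$. *)

theory Defs
  imports "HOL-Probability.Probability"
begin

text \<open>Differentiability is in the Frechet sense; continuity and boundedness of the derivative
  refer to the operator norm.\<close>

definition C1_b :: "('a::real_normed_vector \<Rightarrow> 'b::real_normed_vector) \<Rightarrow> bool" where
  "C1_b f \<longleftrightarrow>
     continuous_on UNIV f \<and> bounded (range f) \<and>
     (\<exists>f' :: 'a \<Rightarrow> 'a \<Rightarrow>\<^sub>L 'b.
        (\<forall>z. (f has_derivative blinfun_apply (f' z)) (at z)) \<and>
        continuous_on UNIV f' \<and> bounded (range f'))"

definition symmetric_kernel :: "('a \<Rightarrow> 'a \<Rightarrow> real) \<Rightarrow> bool" where
  "symmetric_kernel K \<longleftrightarrow> (\<forall>x y. K x y = K y x)"

definition strictly_positive_definite :: "('a \<Rightarrow> 'a \<Rightarrow> real) \<Rightarrow> bool" where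
  "strictly_positive_definite K \<longleftrightarrow>
     (\<forall>(N::nat) (x :: nat \<Rightarrow> 'a) (\<alpha> :: nat \<Rightarrow> real).
        inj_on x {..<N} \<and> (\<exists>j<N. \<alpha> j \<noteq> 0) \<longrightarrow>
        (\<Sum>j<N. \<Sum>l<N. \<alpha> j * \<alpha> l * K (x j) (x l)) > 0)"

text \<open>\<open>is_rkhs K H ip\<close>: the set \<open>H\<close> of continuous real functions, with pointwise operations and
  inner product \<open>ip\<close>, is a real Hilbert space with reproducing kernel \<open>K\<close>. Values of \<open>ip\<close> outside
  \<open>H\<close> are irrelevant.\<close>

definition is_rkhs :: "('a::topological_space \<Rightarrow> 'a \<Rightarrow> real) \<Rightarrow> ('a \<Rightarrow> real) set \<Rightarrow>
    (('a \<Rightarrow> real) \<Rightarrow> ('a \<Rightarrow> real) \<Rightarrow> real) \<Rightarrow> bool" where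
  "is_rkhs K H ip \<longleftrightarrow>
     H \<subseteq> {f. continuous_on UNIV f} \<and>
     (\<lambda>x. 0) \<in> H \<and>
     (\<forall>f\<in>H. \<forall>g\<in>H. (\<lambda>x. f x + g x) \<in> H) \<and>
     (\<forall>c. \<forall>f\<in>H. (\<lambda>x. c * f x) \<in> H) \<and>
     (\<forall>f\<in>H. \<forall>g\<in>H. ip f g = ip g f) \<and>
     (\<forall>f\<in>H. \<forall>g\<in>H. \<forall>h\<in>H. ip (\<lambda>x. f x + g x) h = ip f h + ip g h) \<and>
     (\<forall>c. \<forall>f\<in>H. \<forall>h\<in>H. ip (\<lambda>x. c * f x) h = c * ip f h) \<and>
     (\<forall>f\<in>H. 0 \<le> ip f f \<and> (ip f f = 0 \<longrightarrow> f = (\<lambda>x. 0))) \<and>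
     (\<forall>F :: nat \<Rightarrow> 'a \<Rightarrow> real.
        (\<forall>n. F n \<in> H) \<and>
        (\<forall>e>0. \<exists>n0. \<forall>m\<ge>n0. \<forall>n\<ge>n0.
            sqrt (ip (\<lambda>x. F m x - F n x) (\<lambda>x. F m x - F n x)) < e) \<longrightarrow>
        (\<exists>f\<in>H. (\<lambda>n. sqrt (ip (\<lambda>x. F n x - f x) (\<lambda>x. F n x - f x))) \<longlonglongrightarrow> 0)) \<and>
     (\<forall>x. (\<lambda>y. K y x) \<in> H \<and> (\<forall>f\<in>H. ip f (\<lambda>y. K y x) = f x))"

text \<open>A Hilbert space with a given reproducing kernel is unique as a set of functions with an inner
  product on it; the choice operator is used only because \<open>ip\<close> is undetermined outside \<open>H\<close>.\<close>

definition rkhs :: "('a::topological_space \<Rightarrow> 'a \<Rightarrow> real) \<Rightarrow>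
    ('a \<Rightarrow> real) set \<times> (('a \<Rightarrow> real) \<Rightarrow> ('a \<Rightarrow> real) \<Rightarrow> real)" where
  "rkhs K = (SOME (H, ip). is_rkhs K H ip)"

definition rkhs_space :: "('a::topological_space \<Rightarrow> 'a \<Rightarrow> real) \<Rightarrow> ('a \<Rightarrow> real) set" where
  "rkhs_space K = fst (rkhs K)"

definition rkhs_norm :: "('a::topological_space \<Rightarrow> 'a \<Rightarrow> real) \<Rightarrow> ('a \<Rightarrow> real) \<Rightarrow> real" where
  "rkhs_norm K f = sqrt (snd (rkhs K) f f)"

text \<open>The supremum is taken in \<^typ>\<open>ennreal\<close>, so that the value is nonnegative for
  arbitrary arguments. For a bounded kernel and probability measures it is finite, hence
  \<^const>\<open>enn2real\<close> loses nothing.\<close>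

definition mmd :: "('a::topological_space \<Rightarrow> 'a \<Rightarrow> real) \<Rightarrow> 'a measure \<Rightarrow> 'a measure \<Rightarrow> real" where
  "mmd K \<mu> \<nu> = enn2real
     (SUP f\<in>{f \<in> rkhs_space K. rkhs_norm K f \<le> 1}.
        ennreal \<bar>(\<integral>x. f x \<partial>\<mu>) - (\<integral>x. f x \<partial>\<nu>)\<bar>)"

definition borel_probs :: "'a::topological_space measure set" where
  "borel_probs = {\<mu>. prob_space \<mu> \<and> sets \<mu> = sets borel}"

text \<open>The coarsest topology on the Borel probability measures for which
  \<open>\<mu> \<mapsto> \<integral> f d\<mu>\<close> is continuous for every bounded continuous \<open>f\<close>.\<close>

definition weak_topology :: "'a::topological_space measure topology" where
  "weak_topology = topology_generated_by
     {{\<mu> \<in> borel_probs. (\<integral>x. f x \<partial>\<mu>) \<in> U} | (f :: 'a \<Rightarrow> real) U.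
        continuous_on UNIV f \<and> bounded (range f) \<and> open U}"

definition fourier :: "('a::euclidean_space \<Rightarrow> complex) \<Rightarrow> 'a \<Rightarrow> complex" where
  "fourier \<phi> \<xi> = of_real ((2 * pi) powr (- (real DIM('a) / 2))) *
     (\<integral>x. \<phi> x * exp (- \<i> * of_real (\<xi> \<bullet> x)) \<partial>lborel)"

end

theory Submission
  imports Defs
begin

text \<open>Fourier inversion writes \<open>K(x, y)\<close> as the integral of \<open>w(\<xi>) exp(i \<xi>(x - y))\<close> with
  an integrable density \<open>w > 0\<close>. Hence the space of \<open>K\<close> exists (it is generated by the characters
  in the weighted inner product given by \<open>w\<close>), and testing with the kernel sections shows that
  \<open>\<gamma>(\<mu>, \<nu>)\<close> controls the integral of \<open>w |h|\<^sup>2\<close>, where \<open>h\<close> is the difference of the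
  characteristic functions.

  As \<open>w\<close> is positive everywhere, \<open>\<gamma>(\<mu>, \<nu>) \<rightarrow> 0\<close> then forces the integral of \<open>g h\<close> to tend to
  \<open>0\<close> for every integrable \<open>g\<close>. By Gaussian smoothing, compactly supported continuous functions
  are uniform limits of Fourier integrals of such \<open>g\<close>, so their integrals converge; since no mass
  can escape, convergence is weak. Equality of measures with \<open>\<gamma>(\<mu>, \<nu>) = 0\<close> is a special case.

  Conversely, the unit ball of the space is uniformly bounded and uniformly equicontinuous. By
  tightness of \<open>\<mu>\<close> and a finite partition of unity, the integrals of all its members are
  controlled by finitely many bounded continuous functions, so every ball of \<open>\<gamma>\<close> around \<open>\<mu>\<close>
  contains a weak neighbourhood of \<open>\<mu>\<close>.\<close>

section \<open>Hilbert spaces from feature maps\<close>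

text \<open>\<open>rkhs\<close> is a choice, so nothing is known about the discrepancy until some
  pair satisfying \<open>is_rkhs\<close> has been built; afterwards the chosen pair is accessible
  through those axioms alone. Its elements must be real functions of the points, so the completion
  of the span of the characters is realised directly as a set of pointwise limits of pairings. The
  conclusion is an equality of topologies, and sequences of measures do not detect neighbourhoods in
  the weak topology before it is known to be metrizable. Hence every estimate has a threshold that
  may depend on \<mu> and the test function but serves all \<nu> at once. The delicate one leads
  from the weighted energy to integrals against \<open>g\<close>: an integrable \<open>w\<close> has
  no positive lower bound, and \<open>g / w\<close> is uncontrolled. The threshold is therefore not
  computed; it is obtained by contradiction, from an almost everywhere convergent subsequence of
  counterexamples.\<close>

locale semi_inner =
  fixes B :: "'v::real_vector \<Rightarrow> 'v \<Rightarrow> real"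
  assumes add_left: "B (u + v) w = B u w + B v w"
    and scale_left: "B (c *\<^sub>R u) w = c * B u w"
    and sym: "B u v = B v u"
    and nonneg: "0 \<le> B u u"
begin

definition N :: "'v \<Rightarrow> real" where "N u = sqrt (B u u)"

lemma add_right: "B w (u + v) = B w u + B w v"
  by (metis add_left sym)

lemma scale_right: "B w (c *\<^sub>R u) = c * B w u"
  by (metis scale_left sym)

lemma minus_left: "B (- u) w = - B u w"
  using scale_left[of "-1" u w] by simp

lemma minus_right: "B w (- u) = - B w u"
  by (metis minus_left sym)

lemma diff_left: "B (u - v) w = B u w - B v w"
  using add_left[of u "- v" w] by (simp add: minus_left)

lemma diff_right: "B w (u - v) = B w u - B w v"
  by (metis diff_left sym)

lemma zero_left: "B 0 w = 0"
  using scale_left[of 0 0 w] by simp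

lemma N_nonneg: "0 \<le> N u"
  by (simp add: N_def nonneg)

lemma N_sq: "(N u)\<^sup>2 = B u u"
  by (simp add: N_def nonneg)

lemma N_minus: "N (- u) = N u"
  by (simp add: N_def minus_left minus_right)

lemma N_diff_commute: "N (u - v) = N (v - u)"
  using N_minus[of "u - v"] by simp

lemma N_scale: "N (c *\<^sub>R u) = \<bar>c\<bar> * N u"
  by (simp add: N_def scale_left scale_right real_sqrt_mult flip: mult.assoc power2_eq_square)

end

text \<open>Scalar core of Cauchy-Schwarz. It stands outside the locale because it is applied twice:
  to a form on a whole type and to an inner product on a set of functions.\<close>

lemma quadratic_nonneg_imp_discriminant:
  fixes a b c :: real
  assumes "\<And>t. 0 \<le> a + 2 * t * b + t\<^sup>2 * c" and "0 \<le> a" "0 \<le> c"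
  shows "\<bar>b\<bar> \<le> sqrt a * sqrt c"
proof -
  have "b\<^sup>2 \<le> a * c"
  proof (cases "c = 0")
    case True
    have "b = 0"
    proof (rule ccontr)
      assume "b \<noteq> 0"
      \<comment> \<open>With \<open>c = 0\<close> the expression is affine in \<open>t\<close>, and
        this \<open>t\<close> gives it the value -1.\<close>
      then show False using assms(1)[of "- (a + 1) / (2 * b)"] True by (simp add: field_simps)
    qed
    then show ?thesis using assms by simp
  next
    case False
    then have "c > 0" using assms by simp
    \<comment> \<open>\<open>t = - b / c\<close> is the minimiser of the quadratic.\<close>
    have "0 \<le> c * (a + 2 * (- b / c) * b + (- b / c)\<^sup>2 * c)"
      using assms(1)[of "- b / c"] \<open>c > 0\<close> by (intro mult_nonneg_nonneg) auto
    also have "\<dots> = a * c - b\<^sup>2"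
      using \<open>c > 0\<close> by (simp add: field_simps power2_eq_square)
    finally show ?thesis by simp
  qed
  then show ?thesis
    by (metis real_sqrt_abs real_sqrt_le_iff real_sqrt_mult)
qed

context semi_inner
begin

lemma Cauchy_Schwarz: "\<bar>B u v\<bar> \<le> N u * N v"
  unfolding N_def
proof (rule quadratic_nonneg_imp_discriminant)
  fix t
  show "0 \<le> B u u + 2 * t * B u v + t\<^sup>2 * B v v"
    using nonneg[of "u + t *\<^sub>R v"] sym[of u v]
    by (simp add: add_left add_right scale_left scale_right algebra_simps power2_eq_square)
qed (auto simp: nonneg)

lemma N_triangle: "N (u + v) \<le> N u + N v"
proof (rule power2_le_imp_le)
  have "(N (u + v))\<^sup>2 = (N u)\<^sup>2 + 2 * B u v + (N v)\<^sup>2"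
    using sym[of u v] by (simp add: N_sq add_left add_right)
  then show "(N (u + v))\<^sup>2 \<le> (N u + N v)\<^sup>2"
    using Cauchy_Schwarz[of u v] by (simp add: power2_sum)
qed (simp add: N_nonneg)

lemma N_triangle_diff: "N (u - w) \<le> N (u - v) + N (v - w)"
  using N_triangle[of "u - v" "v - w"] by simp

lemma N_diff_abs: "\<bar>N u - N v\<bar> \<le> N (u - v)"
  using N_triangle[of "u - v" v] N_triangle[of "v - u" u] N_diff_commute[of u v] by simp

text \<open>Reduces limits of \<open>B\<close> to limits of \<open>N\<close> of sums and
  differences, both for their existence and for their independence of the representing
  sequences.\<close>

lemma polarization: "B u v = ((N (u + v))\<^sup>2 - (N (u - v))\<^sup>2) / 4"
  using sym[of u v] by (simp add: N_sq add_left add_right diff_left diff_right)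

text \<open>Stated through \<open>N\<close> because the type may carry a different metric: the later
  instance consists of bounded continuous functions with the supremum norm, whereas \<open>N\<close>
  is a weighted L2 seminorm.\<close>

definition N_Cauchy :: "(nat \<Rightarrow> 'v) \<Rightarrow> bool" where
  "N_Cauchy a \<longleftrightarrow> (\<forall>e>0. \<exists>n0. \<forall>m\<ge>n0. \<forall>n\<ge>n0. N (a m - a n) < e)"

lemma N_Cauchy_const: "N_Cauchy (\<lambda>n. u)"
  by (auto simp: N_Cauchy_def N_def zero_left)

lemma N_Cauchy_add:
  assumes "N_Cauchy a" "N_Cauchy b"
  shows "N_Cauchy (\<lambda>n. a n + b n)"
  unfolding N_Cauchy_def
proof (intro allI impI)
  fix e :: real assume "e > 0"
  then have "e / 2 > 0" by simp
  then obtain n1 n2 where "\<forall>m\<ge>n1. \<forall>n\<ge>n1. N (a m - a n) < e / 2" "\<forall>m\<ge>n2. \<forall>n\<ge>n2. N (b m - b n) < e / 2"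
    using assms unfolding N_Cauchy_def by meson
  moreover have "N (a m + b m - (a n + b n)) \<le> N (a m - a n) + N (b m - b n)" for m n
    using N_triangle[of "a m - a n" "b m - b n"] by (simp add: algebra_simps)
  ultimately have "N (a m + b m - (a n + b n)) < e" if "m \<ge> max n1 n2" "n \<ge> max n1 n2" for m n
    using that by (smt (verit) max.bounded_iff field_sum_of_halves)
  then show "\<exists>n0. \<forall>m\<ge>n0. \<forall>n\<ge>n0. N (a m + b m - (a n + b n)) < e" by blast
qed

lemma N_Cauchy_scale:
  assumes "N_Cauchy a"
  shows "N_Cauchy (\<lambda>n. c *\<^sub>R a n)"
  unfolding N_Cauchy_def
proof (intro allI impI)
  fix e :: real assume "e > 0"
  then have "e / (\<bar>c\<bar> + 1) > 0" by simp
  then obtain n0 where n0: "\<forall>m\<ge>n0. \<forall>n\<ge>n0. N (a m - a n) < e / (\<bar>c\<bar> + 1)"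
    using assms unfolding N_Cauchy_def by meson
  have "N (c *\<^sub>R a m - c *\<^sub>R a n) < e" if "m \<ge> n0" "n \<ge> n0" for m n
  proof -
    have "N (c *\<^sub>R a m - c *\<^sub>R a n) = \<bar>c\<bar> * N (a m - a n)"
      by (simp add: N_scale flip: scaleR_diff_right)
    also have "\<dots> \<le> (\<bar>c\<bar> + 1) * N (a m - a n)"
      by (simp add: mult_right_mono N_nonneg)
    also have "\<dots> < (\<bar>c\<bar> + 1) * (e / (\<bar>c\<bar> + 1))"
      using n0 that by (intro mult_strict_left_mono) auto
    finally show ?thesis by simp
  qed
  then show "\<exists>n0. \<forall>m\<ge>n0. \<forall>n\<ge>n0. N (c *\<^sub>R a m - c *\<^sub>R a n) < e" by blast
qed

lemma N_Cauchy_diff: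
  assumes "N_Cauchy a" "N_Cauchy b"
  shows "N_Cauchy (\<lambda>n. a n - b n)"
  using N_Cauchy_add[OF assms(1) N_Cauchy_scale[OF assms(2), of "-1"]] by simp

lemma N_Cauchy_convergent_N:
  assumes "N_Cauchy a"
  shows "convergent (\<lambda>n. N (a n))"
proof (rule Cauchy_convergent, rule CauchyI)
  fix e :: real assume "0 < e"
  then obtain n0 where "\<forall>m\<ge>n0. \<forall>n\<ge>n0. N (a m - a n) < e"
    using assms unfolding N_Cauchy_def by meson
  then show "\<exists>n0. \<forall>m\<ge>n0. \<forall>n\<ge>n0. norm (N (a m) - N (a n)) < e"
    unfolding real_norm_def using le_less_trans[OF N_diff_abs] by blast
qed

lemma N_Cauchy_convergent_B:
  assumes "N_Cauchy a" "N_Cauchy b"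
  shows "convergent (\<lambda>n. B (a n) (b n))"
proof (subst polarization)
  obtain l where l: "(\<lambda>n. N (a n + b n)) \<longlonglongrightarrow> l"
    using N_Cauchy_convergent_N[OF N_Cauchy_add[OF assms]] by (auto simp: convergent_def)
  obtain l' where l': "(\<lambda>n. N (a n - b n)) \<longlonglongrightarrow> l'"
    using N_Cauchy_convergent_N[OF N_Cauchy_diff[OF assms]] by (auto simp: convergent_def)
  have "(\<lambda>n. ((N (a n + b n))\<^sup>2 - (N (a n - b n))\<^sup>2) / 4) \<longlonglongrightarrow> (l\<^sup>2 - l'\<^sup>2) / 4"
    by (intro tendsto_intros l l') simp
  then show "convergent (\<lambda>n. ((N (a n + b n))\<^sup>2 - (N (a n - b n))\<^sup>2) / 4)"
    by (auto simp: convergent_def)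
qed

end

section \<open>Completion of the span of a feature map as a space of functions\<close>

locale feature_map = semi_inner B for B :: "'v::real_vector \<Rightarrow> 'v \<Rightarrow> real" +
  fixes \<delta> :: "'a::topological_space \<Rightarrow> 'v" and C :: real
  assumes bounded_feature: "N (\<delta> x) \<le> C"
    and continuous_kernel: "continuous_on UNIV (\<lambda>x. B (\<delta> y) (\<delta> x))"
begin

text \<open>An element of the completion is identified with its pairings with the features.
  Confining \<open>a\<close> to their span makes this faithful: a vector orthogonal to all features
  would represent 0 without being null.\<close>

definition represents :: "(nat \<Rightarrow> 'v) \<Rightarrow> ('a \<Rightarrow> real) \<Rightarrow> bool" where
  "represents a f \<longleftrightarrow> range a \<subseteq> span (range \<delta>) \<and> N_Cauchy a \<and> (\<forall>x. (\<lambda>n. B (a n) (\<delta> x)) \<longlonglongrightarrow> f x)"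

definition rep :: "('a \<Rightarrow> real) \<Rightarrow> nat \<Rightarrow> 'v" where
  "rep f = (SOME a. represents a f)"

definition feature_space :: "('a \<Rightarrow> real) set" where
  "feature_space = {f. \<exists>a. represents a f}"

text \<open>The limit exists on \<open>feature_space\<close> by
  \<open>N_Cauchy_convergent_B\<close>, and it does not depend on the chosen sequences by
  \<open>represents_limit_B\<close>.\<close>

definition ip :: "('a \<Rightarrow> real) \<Rightarrow> ('a \<Rightarrow> real) \<Rightarrow> real" where
  "ip f g = lim (\<lambda>n. B (rep f n) (rep g n))"

lemma represents_rep: "f \<in> feature_space \<Longrightarrow> represents (rep f) f"
  unfolding feature_space_def rep_def mem_Collect_eq by (rule someI_ex[of "\<lambda>a. represents a f"])

lemma represents_add:
  assumes "represents a f" "represents b g"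
  shows "represents (\<lambda>n. a n + b n) (\<lambda>x. f x + g x)"
  using assms unfolding represents_def
  by (auto simp: add_left intro!: tendsto_add N_Cauchy_add span_add)

lemma represents_scale:
  assumes "represents a f"
  shows "represents (\<lambda>n. c *\<^sub>R a n) (\<lambda>x. c * f x)"
  using assms unfolding represents_def
  by (auto simp: scale_left intro!: tendsto_mult_left N_Cauchy_scale span_scale)

lemma represents_diff:
  assumes "represents a f" "represents b g"
  shows "represents (\<lambda>n. a n - b n) (\<lambda>x. f x - g x)"
  using represents_add[OF assms(1) represents_scale[OF assms(2), of "-1"]] by simp

lemma represents_kernel: "represents (\<lambda>n. \<delta> y) (\<lambda>x. B (\<delta> y) (\<delta> x))"
  by (auto simp: represents_def N_Cauchy_const intro: span_base)

text \<open>In \<open>(N (a n))\<^sup>2 = B (a n) (a n - a m) + B (a n) (a m)\<close> the first term is small for late \<open>m\<close>,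
  and the second tends to \<open>0\<close> with \<open>n\<close> because \<open>a m\<close> lies in the span of the features.\<close>

lemma represents_zero_null:
  assumes "represents a (\<lambda>x. 0)"
  shows "(\<lambda>n. N (a n)) \<longlonglongrightarrow> 0"
proof -
  have Ca: "N_Cauchy a" and Sa: "\<And>n. a n \<in> span (range \<delta>)"
    and lim0: "\<And>x. (\<lambda>n. B (a n) (\<delta> x)) \<longlonglongrightarrow> 0"
    using assms by (auto simp: represents_def)
  obtain l where l: "(\<lambda>n. N (a n)) \<longlonglongrightarrow> l"
    using N_Cauchy_convergent_N[OF Ca] by (auto simp: convergent_def)
  have l0: "l \<ge> 0"
    by (rule LIMSEQ_le_const[OF l]) (auto simp: N_nonneg)
  have span0: "(\<lambda>n. B (a n) u) \<longlonglongrightarrow> 0" if "u \<in> span (range \<delta>)" for u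
    using that
  proof (induction rule: span_induct_alt)
    case base
    then show ?case using scale_right[of _ 0 0] by simp
  next
    case (step c x y)
    then obtain z where "x = \<delta> z" by auto
    then show ?case
      using tendsto_add[OF tendsto_mult_left[OF lim0[of z], of c] step(2)]
      by (simp add: add_right scale_right)
  qed
  have le: "l * l \<le> l * e" if "e > 0" for e
  proof -
    obtain n0 where n0: "\<forall>m\<ge>n0. \<forall>n\<ge>n0. N (a m - a n) < e"
      using Ca \<open>e > 0\<close> unfolding N_Cauchy_def by meson
    have "(N (a n))\<^sup>2 \<le> N (a n) * e + B (a n) (a n0)" if "n \<ge> n0" for n
    proof -
      have "(N (a n))\<^sup>2 = B (a n) (a n - a n0) + B (a n) (a n0)"
        by (simp add: N_sq diff_right)
      also have "B (a n) (a n - a n0) \<le> N (a n) * N (a n - a n0)"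
        using Cauchy_Schwarz[of "a n" "a n - a n0"] by simp
      also have "\<dots> \<le> N (a n) * e"
        using n0 that by (intro mult_left_mono) (auto simp: N_nonneg less_imp_le)
      finally show ?thesis by simp
    qed
    then have "l\<^sup>2 \<le> l * e + 0"
      by (intro LIMSEQ_le[OF tendsto_power[OF l] tendsto_add[OF tendsto_mult_right[OF l] span0[OF Sa]]])
        blast
    then show ?thesis by (simp add: power2_eq_square)
  qed
  then have "l = 0"
    using l0 le[of "l / 2"] mult_pos_pos[of l l] by (cases "l > 0") auto
  with l show ?thesis by simp
qed

text \<open>The difference of two sequences representing the same function represents 0, hence is
  null in \<open>N\<close>.\<close>

lemma represents_limit_N:
  assumes "represents a f" "represents b f" "(\<lambda>n. N (a n)) \<longlonglongrightarrow> l"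
  shows "(\<lambda>n. N (b n)) \<longlonglongrightarrow> l"
proof -
  have "(\<lambda>n. N (a n - b n)) \<longlonglongrightarrow> 0"
    using represents_zero_null[of "\<lambda>n. a n - b n"] represents_diff[OF assms(1,2)] by simp
  then have "(\<lambda>n. N (a n) - N (b n)) \<longlonglongrightarrow> 0"
    by (rule Lim_null_comparison[rotated]) (simp add: N_diff_abs)
  from tendsto_diff[OF assms(3) this] show ?thesis by simp
qed

lemma represents_limit_B:
  assumes "represents a f" "represents b g" "represents a' f" "represents b' g"
    and "(\<lambda>n. B (a n) (b n)) \<longlonglongrightarrow> l"
  shows "(\<lambda>n. B (a' n) (b' n)) \<longlonglongrightarrow> l"
proof -
  note add = represents_add[OF assms(1,2)] represents_add[OF assms(3,4)]
  note diff = represents_diff[OF assms(1,2)] represents_diff[OF assms(3,4)]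
  obtain s where s: "(\<lambda>n. N (a n + b n)) \<longlonglongrightarrow> s"
    using N_Cauchy_convergent_N[of "\<lambda>n. a n + b n"] add(1) by (auto simp: convergent_def represents_def)
  obtain d where d: "(\<lambda>n. N (a n - b n)) \<longlonglongrightarrow> d"
    using N_Cauchy_convergent_N[of "\<lambda>n. a n - b n"] diff(1) by (auto simp: convergent_def represents_def)
  have "(\<lambda>n. B (a n) (b n)) \<longlonglongrightarrow> (s\<^sup>2 - d\<^sup>2) / 4"
    by (subst polarization) (intro tendsto_intros s d; simp)
  then have "l = (s\<^sup>2 - d\<^sup>2) / 4"
    using assms(5) LIMSEQ_unique by blast
  then show ?thesis
    by (subst polarization, simp only:)
      (intro tendsto_intros represents_limit_N[OF add s] represents_limit_N[OF diff d]; simp)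
qed

lemma ip_limit:
  assumes "represents a f" "represents b g"
  shows "(\<lambda>n. B (a n) (b n)) \<longlonglongrightarrow> ip f g"
proof (rule represents_limit_B)
  show f: "represents (rep f) f" and g: "represents (rep g) g"
    using assms by (auto intro!: represents_rep simp: feature_space_def)
  then show "(\<lambda>n. B (rep f n) (rep g n)) \<longlonglongrightarrow> ip f g"
    unfolding ip_def using N_Cauchy_convergent_B
    by (simp add: convergent_LIMSEQ_iff[symmetric] represents_def)
qed (use assms in auto)

lemma ip_norm_limit:
  assumes "represents a f"
  shows "(\<lambda>n. N (a n)) \<longlonglongrightarrow> sqrt (ip f f)"
  unfolding N_def by (intro tendsto_real_sqrt ip_limit assms)

lemma represented_bound: "\<bar>B u (\<delta> x)\<bar> \<le> N u * C"
  by (rule order_trans[OF Cauchy_Schwarz mult_left_mono[OF bounded_feature N_nonneg]])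

lemma C_nonneg: "0 \<le> C"
  using bounded_feature[of undefined] N_nonneg[of "\<delta> undefined"] by simp

lemma continuous_span:
  assumes "u \<in> span (range \<delta>)"
  shows "continuous_on UNIV (\<lambda>x. B u (\<delta> x))"
  using assms
proof (induction rule: span_induct_alt)
  case base
  then show ?case by (simp add: zero_left)
next
  case (step c x y)
  then show ?case
    using continuous_kernel
    by (auto simp: add_left scale_left intro!: continuous_intros)
qed

lemma N_Cauchy_represents:
  assumes "range a \<subseteq> span (range \<delta>)" "N_Cauchy a"
  obtains f where "represents a f"
proof -
  have "convergent (\<lambda>n. B (a n) (\<delta> x))" for x
    using N_Cauchy_convergent_B[OF assms(2) N_Cauchy_const] .
  then have "represents a (\<lambda>x. lim (\<lambda>n. B (a n) (\<delta> x)))"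
    using assms by (simp add: represents_def convergent_LIMSEQ_iff)
  then show ?thesis using that by blast
qed

text \<open>Bounded features turn \<open>N\<close>-convergence into uniform convergence, so
  continuity passes from the span to the limits.\<close>

lemma continuous_feature_space:
  assumes "f \<in> feature_space"
  shows "continuous_on UNIV f"
proof -
  obtain a where a: "represents a f" using assms by (auto simp: feature_space_def)
  have "uniform_limit UNIV (\<lambda>n x. B (a n) (\<delta> x)) f sequentially"
  proof (rule uniform_limitI)
    fix e :: real assume "e > 0"
    then have "e / (2 * (C + 1)) > 0" using C_nonneg by simp
    then obtain n0 where n0: "\<forall>m\<ge>n0. \<forall>n\<ge>n0. N (a m - a n) < e / (2 * (C + 1))"
      using a unfolding represents_def N_Cauchy_def by meson
    have "dist (B (a n) (\<delta> x)) (f x) < e" if "n \<ge> n0" for n x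
    proof -
      have "(\<lambda>m. \<bar>B (a n) (\<delta> x) - B (a m) (\<delta> x)\<bar>) \<longlonglongrightarrow> \<bar>B (a n) (\<delta> x) - f x\<bar>"
        using a by (auto simp: represents_def intro!: tendsto_intros)
      then have "\<bar>B (a n) (\<delta> x) - f x\<bar> \<le> e / (2 * (C + 1)) * C"
      proof (rule LIMSEQ_le_const2, intro exI allI impI)
        fix m assume "n0 \<le> m"
        have "\<bar>B (a n) (\<delta> x) - B (a m) (\<delta> x)\<bar> \<le> N (a n - a m) * C"
          using represented_bound[of "a n - a m" x] by (simp add: diff_left)
        also have "\<dots> \<le> e / (2 * (C + 1)) * C"
          using n0 \<open>n0 \<le> m\<close> that C_nonneg by (intro mult_right_mono) (auto simp: less_imp_le)
        finally show "\<bar>B (a n) (\<delta> x) - B (a m) (\<delta> x)\<bar> \<le> e / (2 * (C + 1)) * C" .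
      qed
      also have "\<dots> < e"
        using C_nonneg \<open>e > 0\<close> mult_nonneg_nonneg[of C e] by (simp add: field_simps add_nonneg_pos)
      finally show ?thesis by (simp add: dist_real_def)
    qed
    then show "\<forall>\<^sub>F n in sequentially. \<forall>x\<in>UNIV. dist (B (a n) (\<delta> x)) (f x) < e"
      unfolding eventually_sequentially by blast
  qed
  moreover have "continuous_on UNIV (\<lambda>x. B (a n) (\<delta> x))" for n
    using a by (intro continuous_span) (auto simp: represents_def)
  ultimately show ?thesis
    by (auto intro: uniform_limit_theorem[rotated])
qed

text \<open>Diagonal argument: from the sequence representing \<open>F n\<close> a single vector
  \<open>d n\<close> is taken that is within \<open>1 / Suc n\<close> of its tail. The vectors
  \<open>d n\<close> are \<open>N\<close>-Cauchy, and the function they represent is the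
  limit.\<close>

lemma complete_feature_space:
  assumes F: "\<And>n. F n \<in> feature_space"
    and Cauchy: "\<And>e. e > 0 \<Longrightarrow> \<exists>n0. \<forall>m\<ge>n0. \<forall>n\<ge>n0.
      sqrt (ip (\<lambda>x. F m x - F n x) (\<lambda>x. F m x - F n x)) < e"
  shows "\<exists>f\<in>feature_space. (\<lambda>n. sqrt (ip (\<lambda>x. F n x - f x) (\<lambda>x. F n x - f x))) \<longlonglongrightarrow> 0"
proof -
  define A where "A n = rep (F n)" for n
  have A: "represents (A n) (F n)" for n
    unfolding A_def using represents_rep F by blast
  have "\<exists>k. \<forall>j\<ge>k. N (A n j - A n k) < 1 / Suc n" for n
  proof -
    have "(1::real) / Suc n > 0" by simp
    then show ?thesis
      using A[of n] unfolding represents_def N_Cauchy_def by (meson order_refl)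
  qed
  then obtain k where k: "\<And>n j. j \<ge> k n \<Longrightarrow> N (A n j - A n (k n)) < 1 / Suc n"
    by metis
  define d where "d n = A n (k n)" for n
  have lim: "(\<lambda>j. N (A m j - A n j)) \<longlonglongrightarrow> sqrt (ip (\<lambda>x. F m x - F n x) (\<lambda>x. F m x - F n x))" for m n
    using ip_norm_limit[OF represents_diff[OF A A]] .
  \<comment> \<open>Triangle inequality along \<open>d m\<close>, \<open>A m j\<close>,
    \<open>A n j\<close>, \<open>d n\<close>; as \<open>j\<close> grows, the middle distance tends
    to the distance of \<open>F m\<close> and \<open>F n\<close>.\<close>
  have dd: "N (d m - d n) \<le> 1 / Suc m + sqrt (ip (\<lambda>x. F m x - F n x) (\<lambda>x. F m x - F n x)) + 1 / Suc n" for m n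
  proof (rule LIMSEQ_le_const)
    show "(\<lambda>j. 1 / Suc m + N (A m j - A n j) + 1 / Suc n) \<longlonglongrightarrow>
      1 / Suc m + sqrt (ip (\<lambda>x. F m x - F n x) (\<lambda>x. F m x - F n x)) + 1 / Suc n"
      by (intro tendsto_intros lim)
    have "N (d m - d n) \<le> 1 / Suc m + N (A m j - A n j) + 1 / Suc n" if "j \<ge> max (k m) (k n)" for j
      using N_triangle_diff[of "d m" "d n" "A m j"] N_triangle_diff[of "A m j" "d n" "A n j"]
        k[of m j] k[of n j] that N_diff_commute[of "d m" "A m j"] by (simp add: d_def)
    then show "\<exists>M. \<forall>j\<ge>M. N (d m - d n) \<le> 1 / Suc m + N (A m j - A n j) + 1 / Suc n" by blast
  qed
  have small: "\<exists>n0. \<forall>n\<ge>n0. 1 / real (Suc n) < e" if "e > 0" for e :: real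
    using order_tendstoD(2)[OF LIMSEQ_inverse_real_of_nat that]
    by (auto simp: eventually_sequentially inverse_eq_divide)
  have Cd: "N_Cauchy d"
    unfolding N_Cauchy_def
  proof (intro allI impI)
    fix e :: real assume "e > 0"
    then have "e / 3 > 0" by simp
    then obtain n1 n2 where n12: "\<forall>n\<ge>n1. 1 / real (Suc n) < e / 3"
      "\<forall>m\<ge>n2. \<forall>n\<ge>n2. sqrt (ip (\<lambda>x. F m x - F n x) (\<lambda>x. F m x - F n x)) < e / 3"
      using small Cauchy by meson
    have "N (d m - d n) < e" if "m \<ge> max n1 n2" "n \<ge> max n1 n2" for m n
    proof -
      have "1 / real (Suc m) < e / 3" "1 / real (Suc n) < e / 3"
        "sqrt (ip (\<lambda>x. F m x - F n x) (\<lambda>x. F m x - F n x)) < e / 3"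
        using n12 that by auto
      then show ?thesis using dd[of m n] by linarith
    qed
    then show "\<exists>n0. \<forall>m\<ge>n0. \<forall>n\<ge>n0. N (d m - d n) < e" by blast
  qed
  have Sd: "range d \<subseteq> span (range \<delta>)"
    using A unfolding d_def represents_def by blast
  obtain f where f: "represents d f"
    using N_Cauchy_represents[OF Sd Cd] .
  have "(\<lambda>n. sqrt (ip (\<lambda>x. F n x - f x) (\<lambda>x. F n x - f x))) \<longlonglongrightarrow> 0"
  proof (rule LIMSEQ_I)
    fix e :: real assume "e > 0"
    then have "e / 3 > 0" by simp
    then obtain n1 n2 where n12: "\<forall>n\<ge>n1. 1 / real (Suc n) < e / 3"
      "\<forall>m\<ge>n2. \<forall>n\<ge>n2. N (d m - d n) < e / 3"
      using small Cd unfolding N_Cauchy_def by meson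
    have "norm (sqrt (ip (\<lambda>x. F n x - f x) (\<lambda>x. F n x - f x)) - 0) < e" if "n \<ge> max n1 n2" for n
    proof -
      have lim: "(\<lambda>j. N (A n j - d j)) \<longlonglongrightarrow> sqrt (ip (\<lambda>x. F n x - f x) (\<lambda>x. F n x - f x))"
        using ip_norm_limit[OF represents_diff[OF A f]] .
      have "N (A n j - d j) \<le> e / 3 + e / 3" if "j \<ge> max (k n) n2" for j
      proof -
        have "N (A n j - d n) < 1 / real (Suc n)" using k that by (simp add: d_def)
        moreover have "1 / real (Suc n) < e / 3" "N (d n - d j) < e / 3"
          using n12 that \<open>n \<ge> max n1 n2\<close> by auto
        ultimately show ?thesis using N_triangle_diff[of "A n j" "d j" "d n"] by linarith
      qed
      then have "sqrt (ip (\<lambda>x. F n x - f x) (\<lambda>x. F n x - f x)) \<le> e / 3 + e / 3"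
        by (intro LIMSEQ_le_const2[OF lim]) blast
      moreover have "0 \<le> sqrt (ip (\<lambda>x. F n x - f x) (\<lambda>x. F n x - f x))"
        by (rule LIMSEQ_le_const[OF lim]) (auto simp: N_nonneg)
      ultimately show ?thesis using \<open>e > 0\<close> by simp
    qed
    then show "\<exists>n0. \<forall>n\<ge>n0. norm (sqrt (ip (\<lambda>x. F n x - f x) (\<lambda>x. F n x - f x)) - 0) < e" by blast
  qed
  with f show ?thesis by (auto simp: feature_space_def)
qed

text \<open>The section of \<open>K\<close> at \<open>x\<close> is represented by the constant
  sequence at the feature of \<open>x\<close>. Pairing with it therefore yields the limit that
  defines the value at \<open>x\<close>, which is the reproducing property.\<close>

theorem is_rkhs_feature_space:
  assumes K: "\<And>x y. K x y = B (\<delta> x) (\<delta> y)"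
  shows "is_rkhs K feature_space ip"
proof -
  have kernel: "represents (\<lambda>n. \<delta> y) (\<lambda>x. K x y)" for y
    using represents_kernel[of y] K sym by simp
  show ?thesis
    unfolding is_rkhs_def
  proof (intro conjI allI ballI impI)
    show "feature_space \<subseteq> {f. continuous_on UNIV f}" using continuous_feature_space by blast
    show "(\<lambda>x. 0) \<in> feature_space"
      using represents_scale[OF represents_kernel, of 0] by (auto simp: feature_space_def)
    fix f g assume f: "f \<in> feature_space" and g: "g \<in> feature_space"
    then obtain a b where a: "represents a f" and b: "represents b g" by (auto simp: feature_space_def)
    show "(\<lambda>x. f x + g x) \<in> feature_space"
      using represents_add[OF a b] by (auto simp: feature_space_def)
    show "ip f g = ip g f"
      using LIMSEQ_unique[OF ip_limit[OF a b]] ip_limit[OF b a] sym by simp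
    fix h assume "h \<in> feature_space"
    then obtain e where e: "represents e h" by (auto simp: feature_space_def)
    show "ip (\<lambda>x. f x + g x) h = ip f h + ip g h"
      using LIMSEQ_unique[OF ip_limit[OF represents_add[OF a b] e]]
        tendsto_add[OF ip_limit[OF a e] ip_limit[OF b e]] by (simp add: add_left)
  next
    fix c f assume "f \<in> feature_space"
    then obtain a where a: "represents a f" by (auto simp: feature_space_def)
    show "(\<lambda>x. c * f x) \<in> feature_space"
      using represents_scale[OF a] by (auto simp: feature_space_def)
    fix h assume "h \<in> feature_space"
    then obtain e where e: "represents e h" by (auto simp: feature_space_def)
    show "ip (\<lambda>x. c * f x) h = c * ip f h"
      using LIMSEQ_unique[OF ip_limit[OF represents_scale[OF a] e]]
        tendsto_mult_left[OF ip_limit[OF a e]] by (simp add: scale_left)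
  next
    fix f assume "f \<in> feature_space"
    then obtain a where a: "represents a f" by (auto simp: feature_space_def)
    show "0 \<le> ip f f"
      by (rule LIMSEQ_le_const[OF ip_limit[OF a a]]) (auto simp: nonneg)
    assume "ip f f = 0"
    then have "(\<lambda>n. N (a n) * C) \<longlonglongrightarrow> 0"
      using tendsto_mult_right[OF ip_norm_limit[OF a], of C] by simp
    then have "(\<lambda>n. B (a n) (\<delta> x)) \<longlonglongrightarrow> 0" for x
      by (rule Lim_null_comparison[rotated]) (simp add: represented_bound)
    then show "f = (\<lambda>x. 0)"
      using a LIMSEQ_unique unfolding represents_def by blast
  next
    fix F :: "nat \<Rightarrow> 'a \<Rightarrow> real"
    assume "(\<forall>n. F n \<in> feature_space) \<and> (\<forall>e>0. \<exists>n0. \<forall>m\<ge>n0. \<forall>n\<ge>n0.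
            sqrt (ip (\<lambda>x. F m x - F n x) (\<lambda>x. F m x - F n x)) < e)"
    then show "\<exists>f\<in>feature_space. (\<lambda>n. sqrt (ip (\<lambda>x. F n x - f x) (\<lambda>x. F n x - f x))) \<longlonglongrightarrow> 0"
      by (intro complete_feature_space) auto
  next
    fix x
    show "(\<lambda>y. K y x) \<in> feature_space" using kernel by (auto simp: feature_space_def)
    fix f assume "f \<in> feature_space"
    then obtain a where a: "represents a f" by (auto simp: feature_space_def)
    show "ip f (\<lambda>y. K y x) = f x"
      using LIMSEQ_unique[OF ip_limit[OF a kernel]] a by (auto simp: represents_def)
  qed
qed

end

section \<open>Gaussians and Fourier inversion\<close>

lemma borel_measurable_cis [measurable]: "cis \<in> borel_measurable borel"
  by (intro borel_measurable_continuous_onI continuous_intros)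

text \<open>Lebesgue measure on a Euclidean space is the image of a product of one-dimensional ones,
  so Gaussian integrals reduce to the real line.\<close>

lemma lborel_integral_prod_Basis:
  fixes f :: "'a::euclidean_space \<Rightarrow> real \<Rightarrow> complex"
  assumes f: "\<And>b. b \<in> Basis \<Longrightarrow> integrable lborel (f b)"
  shows "integrable lborel (\<lambda>x::'a. \<Prod>b\<in>Basis. f b (x \<bullet> b))"
    and "(\<integral>x. (\<Prod>b\<in>Basis. f b (x \<bullet> b)) \<partial>(lborel :: 'a measure)) = (\<Prod>b\<in>Basis. \<integral>t. f b t \<partial>lborel)"
proof -
  interpret product_sigma_finite "\<lambda>_::'a. lborel :: real measure" by standard
  let ?P = "Pi\<^sub>M (Basis :: 'a set) (\<lambda>_. lborel :: real measure)"
  let ?T = "\<lambda>g. \<Sum>b\<in>Basis. g b *\<^sub>R b :: 'a"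
  have T: "?T \<in> ?P \<rightarrow>\<^sub>M borel" by measurable
  have [measurable]: "f b \<in> borel_measurable borel" if "b \<in> Basis" for b
    using borel_measurable_integrable[OF f[OF that]] by simp
  have m: "(\<lambda>x::'a. \<Prod>b\<in>Basis. f b (x \<bullet> b)) \<in> borel_measurable borel" by measurable
  have eq: "(\<Prod>b\<in>Basis. f b (?T g \<bullet> b)) = (\<Prod>b\<in>Basis. f b (g b))" for g :: "'a \<Rightarrow> real"
    by (intro prod.cong) auto
  show "integrable lborel (\<lambda>x::'a. \<Prod>b\<in>Basis. f b (x \<bullet> b))"
    by (subst lborel_eq, subst integrable_distr_eq[OF T m], unfold eq,
        intro product_integrable_prod finite_Basis f)
  show "(\<integral>x. (\<Prod>b\<in>Basis. f b (x \<bullet> b)) \<partial>(lborel :: 'a measure)) = (\<Prod>b\<in>Basis. \<integral>t. f b t \<partial>lborel)"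
    by (subst lborel_eq, subst integral_distr[OF T m], unfold eq,
        intro product_integral_prod finite_Basis f)
qed

lemma
  fixes f :: "'a::euclidean_space \<Rightarrow> 'b::{banach, second_countable_topology}"
  assumes c: "c \<noteq> 0" and f[measurable]: "f \<in> borel_measurable borel"
  shows lborel_integral_affine:
      "(\<integral>x. f x \<partial>lborel) = \<bar>c\<bar> ^ DIM('a) *\<^sub>R (\<integral>x. f (t + c *\<^sub>R x) \<partial>lborel)"
    and lborel_integrable_affine:
      "integrable lborel f \<longleftrightarrow> integrable lborel (\<lambda>x. f (t + c *\<^sub>R x))"
proof -
  show "(\<integral>x. f x \<partial>lborel) = \<bar>c\<bar> ^ DIM('a) *\<^sub>R (\<integral>x. f (t + c *\<^sub>R x) \<partial>lborel)"
    using c by (subst lborel_affine[of c t]) (auto simp: integral_density integral_distr)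
  show "integrable lborel f \<longleftrightarrow> integrable lborel (\<lambda>x. f (t + c *\<^sub>R x))"
    using c integrable_scaleR_right[of "inverse (\<bar>c\<bar> ^ DIM('a))" lborel
        "\<lambda>x. \<bar>c\<bar> ^ DIM('a) *\<^sub>R f (t + c *\<^sub>R x)"]
    by (subst lborel_affine[of c t]) (auto simp: integrable_density integrable_distr_eq)
qed

text \<open>Left unnormalised, so that it is its own Fourier transform up to the factor
  \<open>sqrt (2 * pi) ^ DIM('a)\<close>.\<close>

definition gauss :: "'a::euclidean_space \<Rightarrow> real" where
  "gauss x = exp (- (norm x)\<^sup>2 / 2)"

lemma gauss_pos: "0 < gauss x"
  by (simp add: gauss_def)

lemma gauss_minus: "gauss (- x) = gauss x"
  by (simp add: gauss_def)

lemma continuous_on_gauss [continuous_intros]: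
  "continuous_on S f \<Longrightarrow> continuous_on S (\<lambda>x. gauss (f x))"
  unfolding gauss_def by (intro continuous_intros) auto

lemma borel_measurable_gauss [measurable]: "gauss \<in> borel_measurable borel"
  by (intro borel_measurable_continuous_onI continuous_intros)

text \<open>Read off from the characteristic function of the standard normal distribution.\<close>

lemma gauss_fourier_real:
  shows "integrable lborel (\<lambda>x::real. complex_of_real (exp (- x\<^sup>2 / 2)) * cis (t * x))"
    and "(\<integral>x. complex_of_real (exp (- x\<^sup>2 / 2)) * cis (t * x) \<partial>lborel) =
      complex_of_real (sqrt (2 * pi) * exp (- t\<^sup>2 / 2))"
proof -
  have eq: "complex_of_real (exp (- x\<^sup>2 / 2)) * cis (t * x) =
      complex_of_real (sqrt (2 * pi)) * (std_normal_density x *\<^sub>R cis (t * x))" for x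
    by (simp add: std_normal_density_def scaleR_conv_of_real)
  have "integrable lborel (\<lambda>x. std_normal_density x *\<^sub>R cis (t * x))"
  proof (rule Bochner_Integration.integrable_bound)
    show "integrable lborel std_normal_density" by simp
  qed (auto simp: norm_mult)
  then show "integrable lborel (\<lambda>x::real. complex_of_real (exp (- x\<^sup>2 / 2)) * cis (t * x))"
    unfolding eq by (intro integrable_mult_right)
  have "char std_normal_distribution t = (\<integral>x. std_normal_density x *\<^sub>R cis (t * x) \<partial>lborel)"
    unfolding char_def by (subst integral_density) (auto simp: cis_conv_exp)
  then show "(\<integral>x. complex_of_real (exp (- x\<^sup>2 / 2)) * cis (t * x) \<partial>lborel) =
      complex_of_real (sqrt (2 * pi) * exp (- t\<^sup>2 / 2))"
    unfolding eq integral_mult_right_zero by (simp add: char_std_normal_distribution)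
qed

lemma gauss_cis_prod:
  "complex_of_real (gauss x) * cis (\<xi> \<bullet> x) =
    (\<Prod>b\<in>Basis. complex_of_real (exp (- (x \<bullet> b)\<^sup>2 / 2)) * cis ((\<xi> \<bullet> b) * (x \<bullet> b)))"
proof -
  have "(norm x)\<^sup>2 = (\<Sum>b\<in>Basis. (x \<bullet> b)\<^sup>2)"
    unfolding power2_norm_eq_inner by (subst euclidean_inner) (simp add: power2_eq_square)
  then have "gauss x = (\<Prod>b\<in>Basis. exp (- (x \<bullet> b)\<^sup>2 / 2))"
    by (simp add: gauss_def exp_sum[symmetric] sum_negf sum_divide_distrib[symmetric])
  moreover have "cis (\<xi> \<bullet> x) = (\<Prod>b\<in>Basis. cis ((\<xi> \<bullet> b) * (x \<bullet> b)))"
    by (simp add: cis_conv_exp exp_sum[symmetric] euclidean_inner[of \<xi> x] sum_distrib_left)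
  ultimately show ?thesis by (simp add: prod.distrib)
qed

lemma gauss_fourier:
  fixes \<xi> :: "'a::euclidean_space"
  shows "integrable lborel (\<lambda>x. complex_of_real (gauss x) * cis (\<xi> \<bullet> x))"
    and "(\<integral>x. complex_of_real (gauss x) * cis (\<xi> \<bullet> x) \<partial>lborel) =
      complex_of_real (sqrt (2 * pi) ^ DIM('a) * gauss \<xi>)"
proof -
  have i: "integrable lborel (\<lambda>t. complex_of_real (exp (- t\<^sup>2 / 2)) * cis ((\<xi> \<bullet> b) * t))" for b
    by (rule gauss_fourier_real)
  show "integrable lborel (\<lambda>x. complex_of_real (gauss x) * cis (\<xi> \<bullet> x))"
    unfolding gauss_cis_prod by (rule lborel_integral_prod_Basis[OF i])
  have "(\<integral>x. complex_of_real (gauss x) * cis (\<xi> \<bullet> x) \<partial>lborel) =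
      (\<Prod>b\<in>Basis. complex_of_real (sqrt (2 * pi) * exp (- (\<xi> \<bullet> b)\<^sup>2 / 2)))"
    unfolding gauss_cis_prod lborel_integral_prod_Basis(2)[OF i] gauss_fourier_real(2) ..
  \<comment> \<open>The factor \<open>cis (0 \<bullet> \<xi>)\<close> is 1; it lets the product
    formula be reused at frequency 0 to reassemble \<open>gauss \<xi>\<close>.\<close>
  also have "\<dots> = complex_of_real (sqrt (2 * pi) ^ DIM('a)) * (complex_of_real (gauss \<xi>) * cis (0 \<bullet> \<xi>))"
    unfolding gauss_cis_prod by (simp add: prod.distrib)
  finally show "(\<integral>x. complex_of_real (gauss x) * cis (\<xi> \<bullet> x) \<partial>lborel) =
      complex_of_real (sqrt (2 * pi) ^ DIM('a) * gauss \<xi>)"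
    by simp
qed

lemma gauss_integral:
  shows "integrable lborel (gauss :: 'a::euclidean_space \<Rightarrow> real)"
    and "(\<integral>x. gauss (x::'a) \<partial>lborel) = sqrt (2 * pi) ^ DIM('a)"
proof -
  have "integrable lborel (\<lambda>x::'a. complex_of_real (gauss x))"
    using gauss_fourier(1)[of "0::'a"] by simp
  then show "integrable lborel (gauss :: 'a \<Rightarrow> real)"
    by (simp add: complex_of_real_integrable_eq)
  have "complex_of_real (\<integral>x. gauss (x::'a) \<partial>lborel) = complex_of_real (sqrt (2 * pi) ^ DIM('a))"
    using gauss_fourier(2)[of "0::'a"] by (simp add: gauss_def flip: of_real_power)
  then show "(\<integral>x. gauss (x::'a) \<partial>lborel) = sqrt (2 * pi) ^ DIM('a)"
    using of_real_eq_iff by blast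
qed

lemma gauss_scaled_fourier:
  fixes x :: "'a::euclidean_space"
  assumes "s > 0"
  shows "integrable lborel (\<lambda>\<xi>::'a. gauss (s *\<^sub>R \<xi>))"
    and "(\<integral>\<xi>. complex_of_real (gauss (s *\<^sub>R \<xi>)) * cis (\<xi> \<bullet> x) \<partial>lborel) =
      complex_of_real (sqrt (2 * pi) ^ DIM('a) / s ^ DIM('a) * gauss (x /\<^sub>R s))"
proof -
  show "integrable lborel (\<lambda>\<xi>::'a. gauss (s *\<^sub>R \<xi>))"
    using lborel_integrable_affine[of s "gauss :: 'a \<Rightarrow> real" 0] gauss_integral(1) assms by auto
  have "(\<integral>\<xi>. complex_of_real (gauss (s *\<^sub>R \<xi>)) * cis (\<xi> \<bullet> x) \<partial>lborel) =
     \<bar>inverse s\<bar> ^ DIM('a) *\<^sub>R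
       (\<integral>\<xi>. complex_of_real (gauss (s *\<^sub>R (0 + inverse s *\<^sub>R \<xi>))) * cis ((0 + inverse s *\<^sub>R \<xi>) \<bullet> x) \<partial>lborel)"
    using assms by (intro lborel_integral_affine) auto
  also have "(\<integral>\<xi>. complex_of_real (gauss (s *\<^sub>R (0 + inverse s *\<^sub>R \<xi>))) * cis ((0 + inverse s *\<^sub>R \<xi>) \<bullet> x) \<partial>lborel) =
    complex_of_real (sqrt (2 * pi) ^ DIM('a) * gauss (x /\<^sub>R s))"
    using assms gauss_fourier(2)[of "x /\<^sub>R s"] by (simp add: inner_commute)
  finally show "(\<integral>\<xi>. complex_of_real (gauss (s *\<^sub>R \<xi>)) * cis (\<xi> \<bullet> x) \<partial>lborel) =
      complex_of_real (sqrt (2 * pi) ^ DIM('a) / s ^ DIM('a) * gauss (x /\<^sub>R s))"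
    using assms by (simp add: scaleR_conv_of_real field_simps)
qed

text \<open>The integrand has absolute value \<open>norm (f x) * norm (g \<xi>)\<close>, so it is
  integrable on the product. The map \<open>T\<close> lets one statement serve the phases
  \<open>x\<close>, \<open>x - y\<close> and \<open>- y\<close>, under Lebesgue measure as well as
  under probability measures.\<close>

lemma fourier_Fubini:
  fixes g :: "'a::euclidean_space \<Rightarrow> complex" and f :: "'b \<Rightarrow> complex" and T :: "'b \<Rightarrow> 'a"
  assumes M: "sigma_finite_measure M"
    and f: "integrable M f" and g: "integrable lborel g" and T[measurable]: "T \<in> borel_measurable M"
  shows "(\<integral>x. f x * (\<integral>\<xi>. g \<xi> * cis (\<xi> \<bullet> T x) \<partial>lborel) \<partial>M) =
    (\<integral>\<xi>. g \<xi> * (\<integral>x. f x * cis (\<xi> \<bullet> T x) \<partial>M) \<partial>lborel)"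
proof -
  interpret M: sigma_finite_measure M by fact
  interpret P: pair_sigma_finite M "lborel :: 'a measure" ..
  have [measurable]: "f \<in> borel_measurable M" "g \<in> borel_measurable borel"
    using f g by (auto dest: borel_measurable_integrable)
  have "integrable (M \<Otimes>\<^sub>M lborel) (\<lambda>(x, \<xi>). f x * g \<xi> * cis (\<xi> \<bullet> T x))"
  proof (rule P.Fubini_integrable)
    have m: "(\<lambda>z. f (fst z) * g (snd z) * cis (snd z \<bullet> T (fst z))) \<in> borel_measurable (M \<Otimes>\<^sub>M lborel)"
      by measurable
    then show "(\<lambda>(x, \<xi>). f x * g \<xi> * cis (\<xi> \<bullet> T x)) \<in> borel_measurable (M \<Otimes>\<^sub>M lborel)"
      by (simp add: case_prod_beta')
    show "integrable M (\<lambda>x. \<integral>\<xi>. norm (case (x, \<xi>) of (x, \<xi>) \<Rightarrow> f x * g \<xi> * cis (\<xi> \<bullet> T x)) \<partial>lborel)"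
      using f by (simp add: norm_mult)
    have "integrable lborel (\<lambda>\<xi>. f x * (g \<xi> * cis (\<xi> \<bullet> T x)))" if "x \<in> space M" for x
    proof (rule integrable_mult_right)
      show "integrable lborel (\<lambda>\<xi>. g \<xi> * cis (\<xi> \<bullet> T x))"
        by (rule Bochner_Integration.integrable_bound[OF g]) (auto simp: norm_mult)
    qed
    then show "AE x in M. integrable lborel (\<lambda>\<xi>. case (x, \<xi>) of (x, \<xi>) \<Rightarrow> f x * g \<xi> * cis (\<xi> \<bullet> T x))"
      by (simp add: mult.assoc)
  qed
  from P.Fubini_integral[OF this] show ?thesis
    by (simp add: mult_ac integral_mult_right_zero[symmetric] del: integral_mult_right_zero)
qed

section \<open>Gaussian smoothing, Fourier inversion and uniform approximation\<close>

definition gauss_smooth :: "real \<Rightarrow> ('a::euclidean_space \<Rightarrow> real) \<Rightarrow> 'a \<Rightarrow> real" where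
  "gauss_smooth s f x = (\<integral>z. gauss z * f (x + s *\<^sub>R z) \<partial>lborel) / sqrt (2 * pi) ^ DIM('a)"

text \<open>\<open>gauss_smooth s f x\<close> is the expectation of
  \<open>f (x + s *\<^sub>R Z)\<close> for a standard Gaussian vector \<open>Z\<close>. For it the
  inversion formula holds for every integrable \<open>f\<close>: the damping factor makes the
  frequency integral absolutely convergent, and Fubini reduces the claim to the transform of the
  Gaussian.\<close>

lemma gauss_smooth_fourier:
  fixes f :: "'a::euclidean_space \<Rightarrow> real"
  assumes f: "integrable lborel f" and s: "s > 0"
  shows "complex_of_real (gauss_smooth s f x) =
    (\<integral>\<xi>. complex_of_real (gauss (s *\<^sub>R \<xi>)) * (\<integral>y. complex_of_real (f y) * cis (- (\<xi> \<bullet> y)) \<partial>lborel) *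
        cis (\<xi> \<bullet> x) \<partial>lborel) / complex_of_real ((2 * pi) ^ DIM('a))"
proof -
  have [measurable]: "f \<in> borel_measurable borel"
    using f by (auto dest: borel_measurable_integrable)
  \<comment> \<open>One factor \<open>c\<close> comes from the transform of the Gaussian, the other
    from the normalisation of \<open>gauss_smooth\<close>; together they give
    \<open>(2 * pi) ^ DIM('a)\<close>.\<close>
  define c where "c = sqrt (2 * pi) ^ DIM('a)"
  have c: "c > 0" "c * c = (2 * pi) ^ DIM('a)"
    unfolding c_def power_mult_distrib[symmetric] by auto
  have shift: "(\<integral>y. complex_of_real (f y) * cis (- (\<xi> \<bullet> y)) \<partial>lborel) * cis (\<xi> \<bullet> x) =
      (\<integral>y. complex_of_real (f y) * cis (\<xi> \<bullet> (x - y)) \<partial>lborel)" for \<xi>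
    unfolding integral_mult_left_zero[symmetric]
    by (simp add: mult.assoc cis_mult inner_diff_right)
  have "(\<integral>\<xi>. complex_of_real (gauss (s *\<^sub>R \<xi>)) * (\<integral>y. complex_of_real (f y) * cis (- (\<xi> \<bullet> y)) \<partial>lborel) *
        cis (\<xi> \<bullet> x) \<partial>lborel) =
     (\<integral>\<xi>. complex_of_real (gauss (s *\<^sub>R \<xi>)) *
        (\<integral>y. complex_of_real (f y) * cis (\<xi> \<bullet> (x - y)) \<partial>lborel) \<partial>lborel)"
    by (simp only: mult.assoc shift)
  also have "\<dots> = (\<integral>y. complex_of_real (f y) *
      (\<integral>\<xi>. complex_of_real (gauss (s *\<^sub>R \<xi>)) * cis (\<xi> \<bullet> (x - y)) \<partial>lborel) \<partial>lborel)"
    using f gauss_scaled_fourier(1)[OF s]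
    by (intro fourier_Fubini[symmetric]) (auto simp: sigma_finite_lborel complex_of_real_integrable_eq)
  also have "\<dots> = (\<integral>y. complex_of_real (f y * (c / s ^ DIM('a) * gauss ((x - y) /\<^sub>R s))) \<partial>lborel)"
    unfolding gauss_scaled_fourier(2)[OF s] c_def by simp
  also have "\<dots> = complex_of_real (\<integral>y. f y * (c / s ^ DIM('a) * gauss ((x - y) /\<^sub>R s)) \<partial>lborel)"
    by (rule integral_complex_of_real)
  also have "(\<integral>y. f y * (c / s ^ DIM('a) * gauss ((x - y) /\<^sub>R s)) \<partial>lborel) =
      \<bar>s\<bar> ^ DIM('a) *\<^sub>R (\<integral>z. f (x + s *\<^sub>R z) * (c / s ^ DIM('a) * gauss ((x - (x + s *\<^sub>R z)) /\<^sub>R s)) \<partial>lborel)"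
    using s by (intro lborel_integral_affine) auto
  also have "\<dots> = s ^ DIM('a) * (\<integral>z. (c / s ^ DIM('a)) * (gauss z * f (x + s *\<^sub>R z)) \<partial>lborel)"
    using s by (simp add: gauss_minus mult_ac)
  also have "\<dots> = c * (\<integral>z. gauss z * f (x + s *\<^sub>R z) \<partial>lborel)"
    using s by simp
  also have "\<dots> = (2 * pi) ^ DIM('a) * gauss_smooth s f x"
    using c by (simp add: gauss_smooth_def flip: c_def) (simp add: field_simps flip: c(2))
  finally show ?thesis by simp
qed

text \<open>\<open>n0\<close> depends on \<open>\<delta>\<close>, \<open>e\<close> and
  \<open>M\<close> but on neither \<open>f\<close> nor \<open>x\<close>; this is what makes uniform
  approximation possible. Displacements shorter than \<open>\<delta>\<close> cost at most
  \<open>e\<close>, longer ones at most \<open>2 * M\<close>, and the Gaussian mass of the latter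
  vanishes as the width shrinks.\<close>

lemma gauss_smooth_close:
  fixes M \<delta> e :: real
  assumes "\<delta> > 0" "e > 0" "M \<ge> 0"
  obtains n0 where "\<And>n (f :: 'a::euclidean_space \<Rightarrow> real) x. n \<ge> n0 \<Longrightarrow> f \<in> borel_measurable borel \<Longrightarrow>
    (\<And>y. \<bar>f y\<bar> \<le> M) \<Longrightarrow> (\<And>y. dist y x < \<delta> \<Longrightarrow> \<bar>f y - f x\<bar> \<le> e) \<Longrightarrow>
    \<bar>gauss_smooth (inverse (real (Suc n))) f x - f x\<bar> \<le> 2 * e"
proof -
  define c where "c = sqrt (2 * pi) ^ DIM('a)"
  have c: "c > 0" by (simp add: c_def)
  note int = gauss_integral[where 'a='a, folded c_def]
  define s where "s n = inverse (real (Suc n))" for n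
  \<comment> \<open>Majorant for the long displacements: the minimum is 1 as soon as
    \<open>s n *\<^sub>R z\<close> has length at least \<open>\<delta>\<close>, and it tends to 0
    for each \<open>z\<close>.\<close>
  define J where "J n = (\<integral>z. gauss (z::'a) * min 1 (s n * norm z / \<delta>) \<partial>lborel)" for n
  have s0: "s n > 0" for n by (simp add: s_def)
  have J_nonneg: "0 \<le> gauss z * min 1 (s n * norm z / \<delta>)" for n and z :: 'a
    using gauss_pos[of z] s0[of n] \<open>\<delta> > 0\<close> by (intro mult_nonneg_nonneg) auto
  have J_bound: "\<bar>gauss z * min 1 (s n * norm z / \<delta>)\<bar> \<le> \<bar>gauss z\<bar>" for n and z :: 'a
    using gauss_pos[of z] J_nonneg[of z n] mult_left_mono[of "min 1 (s n * norm z / \<delta>)" 1 "gauss z"] by simp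
  have Jint: "integrable lborel (\<lambda>z::'a. gauss z * min 1 (s n * norm z / \<delta>))" for n
    by (rule Bochner_Integration.integrable_bound[OF int(1)]) (auto simp: J_bound intro!: AE_I2)
  have "J \<longlonglongrightarrow> (\<integral>z. 0 \<partial>(lborel :: 'a measure))"
    unfolding J_def
  proof (rule integral_dominated_convergence[where w = gauss])
    show "AE z in lborel. (\<lambda>n. gauss (z::'a) * min 1 (s n * norm z / \<delta>)) \<longlonglongrightarrow> 0"
    proof (rule AE_I2)
      fix z :: 'a
      have "s \<longlonglongrightarrow> 0" unfolding s_def by (rule LIMSEQ_inverse_real_of_nat)
      then have "(\<lambda>n. gauss z * min 1 (s n * norm z / \<delta>)) \<longlonglongrightarrow> gauss z * min 1 (0 * norm z / \<delta>)"
        using \<open>\<delta> > 0\<close> by (intro tendsto_intros) auto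
      then show "(\<lambda>n. gauss (z::'a) * min 1 (s n * norm z / \<delta>)) \<longlonglongrightarrow> 0" by simp
    qed
    show "AE z in lborel. norm (gauss (z::'a) * min 1 (s n * norm z / \<delta>)) \<le> gauss z" for n
      using J_bound[of _ n] gauss_pos[where 'a='a]
      by (intro AE_I2) (simp only: real_norm_def abs_of_pos)
  qed (auto simp: int)
  then have "J \<longlonglongrightarrow> 0" by simp
  \<comment> \<open>The aim is \<open>2 * M * J n \<le> c * e\<close>; the added 1 covers
    \<open>M = 0\<close>.\<close>
  moreover have "c * e / (2 * M + 1) > 0" using c assms by simp
  ultimately have "\<forall>\<^sub>F n in sequentially. J n < c * e / (2 * M + 1)" by (rule order_tendstoD)
  then obtain n0 where n0: "\<And>n. n \<ge> n0 \<Longrightarrow> J n < c * e / (2 * M + 1)"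
    by (auto simp: eventually_sequentially)
  show thesis
  proof (rule that)
    fix n and f :: "'a \<Rightarrow> real" and x
    assume n: "n \<ge> n0" and [measurable]: "f \<in> borel_measurable borel"
      and M: "\<And>y. \<bar>f y\<bar> \<le> M" and d: "\<And>y. dist y x < \<delta> \<Longrightarrow> \<bar>f y - f x\<bar> \<le> e"
    have i1: "integrable lborel (\<lambda>z. gauss z * f (x + s n *\<^sub>R z))"
    proof (rule Bochner_Integration.integrable_bound[where f = "\<lambda>z. gauss z * M"])
      show "integrable lborel (\<lambda>z::'a. gauss z * M)" using int by simp
      have "norm (gauss z * f (x + s n *\<^sub>R z)) \<le> norm (gauss z * M)" for z
        unfolding real_norm_def abs_mult using M[of "x + s n *\<^sub>R z"] \<open>M \<ge> 0\<close>
        by (intro mult_left_mono) auto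
      then show "AE z in lborel. norm (gauss z * f (x + s n *\<^sub>R z)) \<le> norm (gauss z * M)"
        by simp
    qed measurable
    have "\<bar>f (x + s n *\<^sub>R z) - f x\<bar> \<le> e + 2 * M * min 1 (s n * norm z / \<delta>)" for z
    proof (cases "dist (x + s n *\<^sub>R z) x < \<delta>")
      case True
      have "0 \<le> 2 * M * min 1 (s n * norm z / \<delta>)"
        using assms s0[of n] by (intro mult_nonneg_nonneg) auto
      then show ?thesis using d[OF True] by simp
    next
      case False
      then have "s n * norm z / \<delta> \<ge> 1"
        using s0[of n] \<open>\<delta> > 0\<close> by (simp add: dist_norm)
      then show ?thesis using M[of x] M[of "x + s n *\<^sub>R z"] \<open>e > 0\<close> by (simp add: min_absorb1)
    qed
    then have b: "\<bar>gauss z * (f (x + s n *\<^sub>R z) - f x)\<bar> \<le>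
        gauss z * (e + 2 * M * min 1 (s n * norm z / \<delta>))" for z
      using gauss_pos[of z] by (simp add: abs_mult)
    have "c * (gauss_smooth (s n) f x - f x) = (\<integral>z. gauss z * f (x + s n *\<^sub>R z) \<partial>lborel) - c * f x"
      using c by (simp add: gauss_smooth_def right_diff_distrib flip: c_def)
    also have "\<dots> = (\<integral>z. gauss z * f (x + s n *\<^sub>R z) - gauss z * f x \<partial>lborel)"
      using i1 int by (subst Bochner_Integration.integral_diff) auto
    finally have "\<bar>c * (gauss_smooth (s n) f x - f x)\<bar> =
        norm (\<integral>z. gauss z * (f (x + s n *\<^sub>R z) - f x) \<partial>lborel)"
      by (simp add: right_diff_distrib)
    also have "\<dots> \<le> (\<integral>z. gauss (z::'a) * (e + 2 * M * min 1 (s n * norm z / \<delta>)) \<partial>lborel)"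
    proof (rule Bochner_Integration.integral_norm_bound_integral)
      show "integrable lborel (\<lambda>z. gauss z * (f (x + s n *\<^sub>R z) - f x))"
        using i1 int by (simp add: right_diff_distrib)
      show "integrable lborel (\<lambda>z::'a. gauss z * (e + 2 * M * min 1 (s n * norm z / \<delta>)))"
        using integrable_mult_right[OF Jint[of n], of "2 * M"] int
        by (simp add: distrib_left mult_ac)
    qed (use b in simp)
    also have "\<dots> = (\<integral>z. e * gauss (z::'a) + 2 * M * (gauss z * min 1 (s n * norm z / \<delta>)) \<partial>lborel)"
      by (simp add: algebra_simps)
    also have "\<dots> = e * c + 2 * M * J n"
      using int integrable_mult_right[OF Jint[of n], of "2 * M"] Jint[of n] unfolding J_def
      by (subst Bochner_Integration.integral_add) auto
    also have "\<dots> \<le> e * c + (2 * M + 1) * J n"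
      using Bochner_Integration.integral_nonneg[of lborel "\<lambda>z::'a. gauss z * min 1 (s n * norm z / \<delta>)"]
        J_nonneg by (intro add_left_mono mult_right_mono) (auto simp: J_def)
    also have "\<dots> \<le> c * (2 * e)"
      using n0[OF n] \<open>M \<ge> 0\<close> by (simp add: field_simps)
    finally have "c * \<bar>gauss_smooth (s n) f x - f x\<bar> \<le> c * (2 * e)"
      using c by (simp add: abs_mult)
    then show "\<bar>gauss_smooth (inverse (real (Suc n))) f x - f x\<bar> \<le> 2 * e"
      using c by (simp add: s_def)
  qed
qed

text \<open>Both sides are limits of the same smoothed values as the width tends to 0: one by
  continuity of \<open>f\<close> at \<open>x\<close>, the other by dominated convergence in
  \<open>gauss_smooth_fourier\<close> with majorant \<open>norm (fhat \<xi>)\<close>.\<close>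

lemma fourier_inversion:
  fixes f :: "'a::euclidean_space \<Rightarrow> real"
  defines "fhat \<equiv> \<lambda>\<xi>. \<integral>y. complex_of_real (f y) * cis (- (\<xi> \<bullet> y)) \<partial>lborel"
  assumes f: "integrable lborel f" "continuous_on UNIV f" "\<And>x. \<bar>f x\<bar> \<le> M"
    and fhat: "integrable lborel fhat"
  shows "complex_of_real (f x) = (\<integral>\<xi>. fhat \<xi> * cis (\<xi> \<bullet> x) \<partial>lborel) / complex_of_real ((2 * pi) ^ DIM('a))"
proof -
  define s where "s n = inverse (real (Suc n))" for n
  have s0: "s n > 0" for n by (simp add: s_def)
  have s_lim: "s \<longlonglongrightarrow> 0" unfolding s_def by (rule LIMSEQ_inverse_real_of_nat)
  have fm: "f \<in> borel_measurable borel" using f(2) by (rule borel_measurable_continuous_onI)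
  have [measurable]: "fhat \<in> borel_measurable borel"
    using fhat by (auto dest: borel_measurable_integrable)
  have "M \<ge> 0" using f(3)[of 0] by simp
  have "(\<lambda>n. gauss_smooth (s n) f x) \<longlonglongrightarrow> f x"
  proof (rule LIMSEQ_I)
    fix r :: real assume "r > 0"
    then have r: "r / 4 > 0" by simp
    have "isCont f x" using f(2) by (simp add: continuous_on_eq_continuous_at)
    then obtain \<delta> where \<delta>: "\<delta> > 0" "\<And>y. dist y x < \<delta> \<Longrightarrow> \<bar>f y - f x\<bar> < r / 4"
      using r unfolding continuous_at_eps_delta dist_real_def by blast
    obtain n0 where n0: "\<And>n (f :: 'a \<Rightarrow> real) x. n \<ge> n0 \<Longrightarrow> f \<in> borel_measurable borel \<Longrightarrow>
        (\<And>y. \<bar>f y\<bar> \<le> M) \<Longrightarrow> (\<And>y. dist y x < \<delta> \<Longrightarrow> \<bar>f y - f x\<bar> \<le> r / 4) \<Longrightarrow>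
        \<bar>gauss_smooth (inverse (real (Suc n))) f x - f x\<bar> \<le> 2 * (r / 4)"
      using gauss_smooth_close[OF \<delta>(1) r \<open>M \<ge> 0\<close>] by metis
    have "norm (gauss_smooth (s n) f x - f x) < r" if "n \<ge> n0" for n
      using n0[OF that fm f(3) less_imp_le[OF \<delta>(2)]] \<open>r > 0\<close> by (simp add: s_def)
    then show "\<exists>n0. \<forall>n\<ge>n0. norm (gauss_smooth (s n) f x - f x) < r" by blast
  qed
  then have lim1: "(\<lambda>n. complex_of_real (gauss_smooth (s n) f x)) \<longlonglongrightarrow> complex_of_real (f x)"
    by (rule tendsto_of_real)
  have "(\<lambda>n. \<integral>\<xi>. complex_of_real (gauss (s n *\<^sub>R \<xi>)) * fhat \<xi> * cis (\<xi> \<bullet> x) \<partial>lborel) \<longlonglongrightarrow>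
    (\<integral>\<xi>. fhat \<xi> * cis (\<xi> \<bullet> x) \<partial>lborel)"
  proof (rule integral_dominated_convergence[where w = "\<lambda>\<xi>. norm (fhat \<xi>)"])
    show "AE \<xi> in lborel. (\<lambda>n. complex_of_real (gauss (s n *\<^sub>R \<xi>)) * fhat \<xi> * cis (\<xi> \<bullet> x))
        \<longlonglongrightarrow> fhat \<xi> * cis (\<xi> \<bullet> x)"
    proof (rule AE_I2)
      fix \<xi> :: 'a
      have "isCont gauss (0 :: 'a)"
        using continuous_on_gauss[OF continuous_on_id, of "UNIV :: 'a set"]
        by (simp add: continuous_on_eq_continuous_at)
      moreover have "(\<lambda>n. s n *\<^sub>R \<xi>) \<longlonglongrightarrow> 0 *\<^sub>R \<xi>" by (intro tendsto_scaleR s_lim tendsto_const)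
      ultimately have "(\<lambda>n. gauss (s n *\<^sub>R \<xi>)) \<longlonglongrightarrow> gauss (0 :: 'a)"
        by (intro isCont_tendsto_compose[of 0 gauss]) simp_all
      then have "(\<lambda>n. complex_of_real (gauss (s n *\<^sub>R \<xi>)) * fhat \<xi> * cis (\<xi> \<bullet> x))
        \<longlonglongrightarrow> complex_of_real (gauss (0 :: 'a)) * fhat \<xi> * cis (\<xi> \<bullet> x)"
        by (intro tendsto_mult tendsto_const tendsto_of_real)
      then show "(\<lambda>n. complex_of_real (gauss (s n *\<^sub>R \<xi>)) * fhat \<xi> * cis (\<xi> \<bullet> x))
        \<longlonglongrightarrow> fhat \<xi> * cis (\<xi> \<bullet> x)" by (simp add: gauss_def)
    qed
    show "AE \<xi> in lborel. norm (complex_of_real (gauss (s n *\<^sub>R \<xi>)) * fhat \<xi> * cis (\<xi> \<bullet> x)) \<le> norm (fhat \<xi>)" for n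
      by (intro AE_I2) (simp add: norm_mult gauss_def mult_left_le_one_le)
  qed (use fhat in auto)
  from tendsto_divide[OF this tendsto_const[of "complex_of_real ((2 * pi) ^ DIM('a))"]]
  have lim2: "(\<lambda>n. complex_of_real (gauss_smooth (s n) f x)) \<longlonglongrightarrow>
      (\<integral>\<xi>. fhat \<xi> * cis (\<xi> \<bullet> x) \<partial>lborel) / complex_of_real ((2 * pi) ^ DIM('a))"
    unfolding gauss_smooth_fourier[OF f(1) s0] fhat_def by simp
  show ?thesis by (rule LIMSEQ_unique[OF lim1 lim2])
qed

text \<open>The transform of a merely continuous \<open>f\<close> may fail to be integrable. Here
  \<open>g\<close> is that bounded transform multiplied by a Gaussian, so it is integrable, and its
  Fourier integral is a smoothed \<open>f\<close>, uniformly close because \<open>f\<close> is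
  uniformly continuous.\<close>

lemma compact_support_uniform_approx_fourier:
  fixes f :: "'a::euclidean_space \<Rightarrow> real"
  assumes cont: "continuous_on UNIV f" and supp: "\<And>x. x \<notin> cball 0 R \<Longrightarrow> f x = 0" and "e > 0"
  shows "\<exists>g :: 'a \<Rightarrow> complex. integrable lborel g \<and>
    (\<forall>x. \<bar>f x - Re (\<integral>\<xi>. g \<xi> * cis (\<xi> \<bullet> x) \<partial>lborel)\<bar> \<le> e)"
proof -
  have fm[measurable]: "f \<in> borel_measurable borel" using cont by (rule borel_measurable_continuous_onI)
  have "integrable lborel (\<lambda>x. indicator (cball 0 R) x *\<^sub>R f x)"
    by (intro borel_integrable_compact continuous_on_subset[OF cont]) auto
  moreover have "(\<lambda>x. indicator (cball 0 R) x *\<^sub>R f x) = f"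
  proof
    show "indicator (cball 0 R) x *\<^sub>R f x = f x" for x
      using supp[of x] by (cases "x \<in> cball 0 R") simp_all
  qed
  ultimately have f_int: "integrable lborel f" by simp
  have "bounded (f ` cball 0 R)"
    by (intro compact_imp_bounded compact_continuous_image continuous_on_subset[OF cont]) auto
  then obtain M where "\<forall>y\<in>f ` cball 0 R. norm y \<le> M"
    unfolding bounded_iff by blast
  then have M: "\<bar>f x\<bar> \<le> M" if "x \<in> cball 0 R" for x
    using that by auto
  have M': "\<bar>f x\<bar> \<le> \<bar>M\<bar>" for x
    using M[of x] supp[of x] by (cases "x \<in> cball 0 R") auto
  have "e / 2 > 0" using \<open>e > 0\<close> by simp
  \<comment> \<open>The margin 1, together with \<open>\<delta> \<le> 1\<close>, keeps both points
    in one compact ball as soon as one of them lies in \<open>cball 0 R\<close>; otherwise both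
    values are 0.\<close>
  have "uniformly_continuous_on (cball 0 (R + 1)) f"
    by (intro compact_uniformly_continuous continuous_on_subset[OF cont]) auto
  then obtain d where d: "d > 0" "\<And>x y. x \<in> cball 0 (R + 1) \<Longrightarrow> y \<in> cball 0 (R + 1) \<Longrightarrow> dist y x < d \<Longrightarrow>
      dist (f y) (f x) < e / 2"
    using \<open>e / 2 > 0\<close> unfolding uniformly_continuous_on_def by blast
  define \<delta> where "\<delta> = min d 1"
  have \<delta>: "\<delta> > 0" using d(1) by (simp add: \<delta>_def)
  have unif: "\<bar>f y - f x\<bar> \<le> e / 2" if "dist y x < \<delta>" for x y
  proof (cases "x \<in> cball 0 R \<or> y \<in> cball 0 R")
    case True
    have "norm x \<le> norm y + dist y x" "norm y \<le> norm x + dist y x"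
      using norm_triangle_sub[of x y] norm_triangle_sub[of y x] by (simp_all add: dist_norm norm_minus_commute)
    then have "x \<in> cball 0 (R + 1)" "y \<in> cball 0 (R + 1)"
      using True that by (auto simp: \<delta>_def)
    then show ?thesis using d(2)[of x y] that by (simp add: \<delta>_def dist_real_def)
  next
    case False
    then show ?thesis using supp \<open>e > 0\<close> by simp
  qed
  obtain n0 where n0: "\<And>n (f :: 'a \<Rightarrow> real) x. n \<ge> n0 \<Longrightarrow> f \<in> borel_measurable borel \<Longrightarrow>
      (\<And>y. \<bar>f y\<bar> \<le> \<bar>M\<bar>) \<Longrightarrow> (\<And>y. dist y x < \<delta> \<Longrightarrow> \<bar>f y - f x\<bar> \<le> e / 2) \<Longrightarrow>
      \<bar>gauss_smooth (inverse (real (Suc n))) f x - f x\<bar> \<le> 2 * (e / 2)"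
    using gauss_smooth_close[OF \<delta> \<open>e / 2 > 0\<close> abs_ge_zero[of M]] by metis
  define s where "s = inverse (real (Suc n0))"
  have "s > 0" by (simp add: s_def)
  define fhat where "fhat \<xi> = (\<integral>y. complex_of_real (f y) * cis (- (\<xi> \<bullet> y)) \<partial>lborel)" for \<xi>
  define g where "g \<xi> = complex_of_real (gauss (s *\<^sub>R \<xi>)) * fhat \<xi> / complex_of_real ((2 * pi) ^ DIM('a))" for \<xi>
  have fhat_m[measurable]: "fhat \<in> borel_measurable borel"
    unfolding fhat_def by measurable
  have fhat_le: "norm (fhat \<xi>) \<le> (\<integral>y. \<bar>f y\<bar> \<partial>lborel)" for \<xi>
  proof -
    have "norm (fhat \<xi>) \<le> (\<integral>y. norm (complex_of_real (f y) * cis (- (\<xi> \<bullet> y))) \<partial>lborel)"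
      unfolding fhat_def by (rule integral_norm_bound)
    then show ?thesis by (simp add: norm_mult)
  qed
  show ?thesis
  proof (intro exI[of _ g] conjI allI)
    have "integrable lborel (\<lambda>\<xi>. complex_of_real (gauss (s *\<^sub>R \<xi>)) * fhat \<xi>)"
    proof (rule Bochner_Integration.integrable_bound)
      show "integrable lborel (\<lambda>\<xi>::'a. gauss (s *\<^sub>R \<xi>) * (\<integral>y. \<bar>f y\<bar> \<partial>lborel))"
        using gauss_scaled_fourier(1)[OF \<open>s > 0\<close>] by (rule integrable_mult_left)
      show "AE \<xi> in lborel. norm (complex_of_real (gauss (s *\<^sub>R \<xi>)) * fhat \<xi>) \<le>
          norm (gauss (s *\<^sub>R \<xi>) * (\<integral>y. \<bar>f y\<bar> \<partial>lborel))"
        using fhat_le by (intro AE_I2) (simp add: norm_mult abs_mult mult_left_mono)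
    qed measurable
    then show "integrable lborel g"
      unfolding g_def by (rule integrable_divide)
    fix x
    have "complex_of_real (gauss_smooth s f x) = (\<integral>\<xi>. g \<xi> * cis (\<xi> \<bullet> x) \<partial>lborel)"
      unfolding gauss_smooth_fourier[OF f_int \<open>s > 0\<close>] g_def fhat_def[symmetric]
        integral_divide_zero[symmetric] times_divide_eq_left ..
    then have "Re (\<integral>\<xi>. g \<xi> * cis (\<xi> \<bullet> x) \<partial>lborel) = gauss_smooth s f x"
      by (metis Re_complex_of_real)
    then show "\<bar>f x - Re (\<integral>\<xi>. g \<xi> * cis (\<xi> \<bullet> x) \<partial>lborel)\<bar> \<le> e"
      using n0[OF order_refl fm M' unif, of x] by (simp add: s_def abs_minus_commute)
  qed
qed

section \<open>Maximum mean discrepancy and weak neighbourhoods\<close>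

context
  fixes K :: "'a::topological_space \<Rightarrow> 'a \<Rightarrow> real" and H ip
  assumes rkhs: "is_rkhs K H ip"
begin

lemma rkhs_kernel_mem: "(\<lambda>y. K y x) \<in> H"
  using rkhs by (simp add: is_rkhs_def)

lemma rkhs_add_mem: "f \<in> H \<Longrightarrow> g \<in> H \<Longrightarrow> (\<lambda>x. f x + g x) \<in> H"
  using rkhs by (simp add: is_rkhs_def)

lemma rkhs_scale_mem: "f \<in> H \<Longrightarrow> (\<lambda>x. c * f x) \<in> H"
  using rkhs by (simp add: is_rkhs_def)

lemma rkhs_continuous: "f \<in> H \<Longrightarrow> continuous_on UNIV f"
  using rkhs by (auto simp: is_rkhs_def)

lemma rkhs_reproducing: "f \<in> H \<Longrightarrow> ip f (\<lambda>y. K y x) = f x"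
  using rkhs by (simp add: is_rkhs_def)

lemma rkhs_ip_sym: "f \<in> H \<Longrightarrow> g \<in> H \<Longrightarrow> ip f g = ip g f"
  using rkhs unfolding is_rkhs_def by blast

lemma rkhs_ip_add: "f \<in> H \<Longrightarrow> g \<in> H \<Longrightarrow> h \<in> H \<Longrightarrow> ip (\<lambda>x. f x + g x) h = ip f h + ip g h"
  using rkhs unfolding is_rkhs_def by blast

lemma rkhs_ip_scale: "f \<in> H \<Longrightarrow> h \<in> H \<Longrightarrow> ip (\<lambda>x. c * f x) h = c * ip f h"
  using rkhs unfolding is_rkhs_def by blast

lemma rkhs_ip_nonneg: "f \<in> H \<Longrightarrow> 0 \<le> ip f f"
  using rkhs unfolding is_rkhs_def by blast

lemma rkhs_ip_zero: "f \<in> H \<Longrightarrow> ip f f = 0 \<Longrightarrow> f = (\<lambda>x. 0)"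
  using rkhs unfolding is_rkhs_def by blast

text \<open>\<open>semi_inner\<close> speaks about a whole type, while \<open>ip\<close> is
  unspecified outside \<open>H\<close>; the argument is repeated here with the membership
  conditions.\<close>

lemma rkhs_Cauchy_Schwarz:
  assumes f: "f \<in> H" and g: "g \<in> H"
  shows "\<bar>ip f g\<bar> \<le> sqrt (ip f f) * sqrt (ip g g)"
proof (rule quadratic_nonneg_imp_discriminant)
  fix t
  let ?h = "\<lambda>x. f x + t * g x"
  have h: "?h \<in> H" using f g by (intro rkhs_add_mem rkhs_scale_mem)
  have tg: "(\<lambda>x. t * g x) \<in> H" using g by (rule rkhs_scale_mem)
  have l: "ip ?h k = ip f k + t * ip g k" if "k \<in> H" for k
    using rkhs_ip_add[OF f tg that] rkhs_ip_scale[OF g that] by simp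
  have "ip ?h ?h = ip f f + t * ip g f + t * (ip f g + t * ip g g)"
    using l[OF h] l[OF f] l[OF g] rkhs_ip_sym[OF f h] rkhs_ip_sym[OF g h] rkhs_ip_sym[OF f g] by simp
  then show "0 \<le> ip f f + 2 * t * ip f g + t\<^sup>2 * ip g g"
    using rkhs_ip_nonneg[OF h] rkhs_ip_sym[OF f g] by (simp add: algebra_simps power2_eq_square)
qed (auto intro: rkhs_ip_nonneg f g)

lemma rkhs_eval_bound:
  assumes "f \<in> H"
  shows "\<bar>f x\<bar> \<le> sqrt (ip f f) * sqrt (K x x)"
  using rkhs_Cauchy_Schwarz[OF assms rkhs_kernel_mem, of x]
  by (simp add: rkhs_reproducing rkhs_kernel_mem assms)

text \<open>\<open>f x - f y\<close> is the inner product of \<open>f\<close> with the difference of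
  the kernel sections at \<open>x\<close> and \<open>y\<close>, and the radicand is the squared norm
  of that difference.\<close>

lemma rkhs_eval_diff_bound:
  assumes f: "f \<in> H"
  shows "\<bar>f x - f y\<bar> \<le> sqrt (ip f f) * sqrt (K x x - K x y - K y x + K y y)"
proof -
  \<comment> \<open>Written with \<open>(-1) *\<close> because the axioms in \<open>is_rkhs\<close>
    provide linearity for sums and scalar multiples.\<close>
  define g where "g = (\<lambda>z. K z x + (-1) * K z y)"
  have y: "(\<lambda>z. (-1) * K z y) \<in> H" by (intro rkhs_scale_mem rkhs_kernel_mem)
  have g: "g \<in> H" unfolding g_def by (intro rkhs_add_mem y rkhs_kernel_mem)
  have eval: "ip h g = h x - h y" if h: "h \<in> H" for h
  proof -
    have "ip g h = ip (\<lambda>z. K z x) h + (-1) * ip (\<lambda>z. K z y) h"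
      unfolding g_def rkhs_ip_add[OF rkhs_kernel_mem y h] rkhs_ip_scale[OF rkhs_kernel_mem h] ..
    then show ?thesis
      using h by (simp add: rkhs_ip_sym[OF h] g rkhs_ip_sym[OF rkhs_kernel_mem h] rkhs_reproducing)
  qed
  have "ip g g = K x x - K x y - K y x + K y y"
    unfolding eval[OF g] by (simp add: g_def)
  then show ?thesis
    using rkhs_Cauchy_Schwarz[OF f g] eval[OF f] by simp
qed

end

section \<open>Integrals of bounded functions under Borel probability measures\<close>

lemma borel_probs_prob_space: "\<mu> \<in> borel_probs \<Longrightarrow> prob_space \<mu>"
  and borel_probs_sets: "\<mu> \<in> borel_probs \<Longrightarrow> sets \<mu> = sets borel"
  by (auto simp: borel_probs_def)

lemma borel_probs_space: "\<mu> \<in> borel_probs \<Longrightarrow> space \<mu> = UNIV"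
  using sets_eq_imp_space_eq[OF borel_probs_sets, of \<mu>] by simp

lemma borel_probs_measurable_cong:
  "\<mu> \<in> borel_probs \<Longrightarrow> f \<in> borel_measurable borel \<Longrightarrow> f \<in> borel_measurable \<mu>"
  using measurable_cong_sets[OF borel_probs_sets refl] by blast

lemma borel_probs_integrable:
  fixes f :: "'a::topological_space \<Rightarrow> 'b::{banach, second_countable_topology}"
  assumes "\<mu> \<in> borel_probs" "f \<in> borel_measurable borel" "\<And>x. norm (f x) \<le> C"
  shows "integrable \<mu> f"
proof -
  interpret prob_space \<mu> using assms(1) by (rule borel_probs_prob_space)
  show ?thesis
  proof (rule integrable_const_bound)
    show "AE x in \<mu>. norm (f x) \<le> C" using assms(3) by simp
    show "f \<in> borel_measurable \<mu>" using assms(1,2) by (rule borel_probs_measurable_cong)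
  qed
qed

lemma borel_probs_integral_bound:
  fixes f :: "'a::topological_space \<Rightarrow> 'b::{banach, second_countable_topology}"
  assumes "\<mu> \<in> borel_probs" "f \<in> borel_measurable borel" "\<And>x. norm (f x) \<le> C"
  shows "norm (\<integral>x. f x \<partial>\<mu>) \<le> C"
proof -
  interpret prob_space \<mu> using assms(1) by (rule borel_probs_prob_space)
  have "norm (\<integral>x. f x \<partial>\<mu>) \<le> (\<integral>x. norm (f x) \<partial>\<mu>)" by simp
  also have "\<dots> \<le> (\<integral>x. C \<partial>\<mu>)"
    using borel_probs_integrable[OF assms] assms(3) by (intro integral_mono integrable_norm) auto
  finally show ?thesis by (simp add: prob_space)
qed

section \<open>The discrepancy of a kernel with bounded diagonal\<close>

locale bounded_rkhs =
  fixes K :: "'a::topological_space \<Rightarrow> 'a \<Rightarrow> real" and C :: real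
  assumes rkhs_exists: "\<exists>H ip. is_rkhs K H ip"
    and kernel_bound: "K x x \<le> C"
begin

definition unit_ball :: "('a \<Rightarrow> real) set" where
  "unit_ball = {f \<in> rkhs_space K. rkhs_norm K f \<le> 1}"

text \<open>Discharges the choice in \<open>rkhs\<close> by the assumed existence.\<close>

lemma is_rkhs: "is_rkhs K (rkhs_space K) (snd (rkhs K))"
proof -
  have "case rkhs K of (H, ip) \<Rightarrow> is_rkhs K H ip"
    unfolding rkhs_def using rkhs_exists by (intro someI_ex[of "\<lambda>(H, ip). is_rkhs K H ip"]) auto
  then show ?thesis by (simp add: rkhs_space_def case_prod_beta)
qed

lemma kernel_nonneg: "0 \<le> K x x"
  using rkhs_ip_nonneg[OF is_rkhs rkhs_kernel_mem[OF is_rkhs], of x]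
    rkhs_reproducing[OF is_rkhs rkhs_kernel_mem[OF is_rkhs], of x x] by simp

lemma rkhs_norm_nonneg: "f \<in> rkhs_space K \<Longrightarrow> 0 \<le> rkhs_norm K f"
  unfolding rkhs_norm_def using rkhs_ip_nonneg[OF is_rkhs] by simp

lemma unit_ball_bound:
  assumes "f \<in> unit_ball"
  shows "\<bar>f x\<bar> \<le> sqrt C"
proof -
  have "\<bar>f x\<bar> \<le> rkhs_norm K f * sqrt (K x x)"
    using rkhs_eval_bound[OF is_rkhs] assms by (auto simp: unit_ball_def rkhs_norm_def)
  also have "\<dots> \<le> 1 * sqrt C"
    using assms kernel_bound kernel_nonneg by (intro mult_mono) (auto simp: unit_ball_def)
  finally show ?thesis by simp
qed

lemma unit_ball_diff_bound:
  assumes "f \<in> unit_ball"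
  shows "\<bar>f x - f y\<bar> \<le> sqrt \<bar>K x x - K x y - K y x + K y y\<bar>"
proof -
  have "\<bar>f x - f y\<bar> \<le> rkhs_norm K f * sqrt (K x x - K x y - K y x + K y y)"
    using rkhs_eval_diff_bound[OF is_rkhs] assms by (auto simp: unit_ball_def rkhs_norm_def)
  also have "\<dots> \<le> rkhs_norm K f * sqrt \<bar>K x x - K x y - K y x + K y y\<bar>"
    using assms rkhs_norm_nonneg by (intro mult_left_mono) (auto simp: unit_ball_def)
  also have "\<dots> \<le> 1 * sqrt \<bar>K x x - K x y - K y x + K y y\<bar>"
    using assms by (intro mult_right_mono) (auto simp: unit_ball_def)
  finally show ?thesis by simp
qed

lemma unit_ball_continuous: "f \<in> unit_ball \<Longrightarrow> continuous_on UNIV f"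
  using rkhs_continuous[OF is_rkhs] by (auto simp: unit_ball_def)

lemma unit_ball_measurable: "f \<in> unit_ball \<Longrightarrow> f \<in> borel_measurable borel"
  by (intro borel_measurable_continuous_onI unit_ball_continuous)

lemma mmd_eq: "mmd K \<mu> \<nu> = enn2real (SUP f\<in>unit_ball. ennreal \<bar>(\<integral>x. f x \<partial>\<mu>) - (\<integral>x. f x \<partial>\<nu>)\<bar>)"
  by (simp add: mmd_def unit_ball_def)

lemma mmd_nonneg: "0 \<le> mmd K \<mu> \<nu>"
  by (simp add: mmd_def)

lemma mmd_commute: "mmd K \<mu> \<nu> = mmd K \<nu> \<mu>"
  by (simp add: mmd_def abs_minus_commute)

lemma mmd_least:
  assumes "\<And>f. f \<in> unit_ball \<Longrightarrow> \<bar>(\<integral>x. f x \<partial>\<mu>) - (\<integral>x. f x \<partial>\<nu>)\<bar> \<le> e" "0 \<le> e"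
  shows "mmd K \<mu> \<nu> \<le> e"
  unfolding mmd_eq using assms by (intro enn2real_leI SUP_least ennreal_leI) auto

text \<open>\<open>enn2real\<close> maps infinity to 0, so the supremum must first be seen to be
  finite. The bound \<open>2 * sqrt C\<close> does this, as members of the unit ball are bounded by
  \<open>sqrt C\<close>.\<close>

lemma mmd_upper:
  assumes "\<mu> \<in> borel_probs" "\<nu> \<in> borel_probs" "f \<in> unit_ball"
  shows "\<bar>(\<integral>x. f x \<partial>\<mu>) - (\<integral>x. f x \<partial>\<nu>)\<bar> \<le> mmd K \<mu> \<nu>"
proof -
  have *: "\<bar>(\<integral>x. g x \<partial>\<mu>) - (\<integral>x. g x \<partial>\<nu>)\<bar> \<le> 2 * sqrt C" if "g \<in> unit_ball" for g
  proof -
    have "norm (\<integral>x. g x \<partial>\<mu>) \<le> sqrt C" "norm (\<integral>x. g x \<partial>\<nu>) \<le> sqrt C"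
      using assms(1,2) that
      by (auto simp del: real_norm_def intro!: borel_probs_integral_bound unit_ball_measurable)
        (auto simp: unit_ball_bound)
    then show ?thesis by simp
  qed
  let ?S = "SUP f\<in>unit_ball. ennreal \<bar>(\<integral>x. f x \<partial>\<mu>) - (\<integral>x. f x \<partial>\<nu>)\<bar>"
  have "?S \<le> ennreal (2 * sqrt C)"
    using * by (intro SUP_least ennreal_leI)
  then have "?S < \<top>" using ennreal_less_top le_less_trans by blast
  then have "ennreal (mmd K \<mu> \<nu>) = ?S"
    unfolding mmd_eq by (simp add: less_top)
  moreover have "ennreal \<bar>(\<integral>x. f x \<partial>\<mu>) - (\<integral>x. f x \<partial>\<nu>)\<bar> \<le> ?S"
    using assms(3) by (rule SUP_upper)
  ultimately have "ennreal \<bar>(\<integral>x. f x \<partial>\<mu>) - (\<integral>x. f x \<partial>\<nu>)\<bar> \<le> ennreal (mmd K \<mu> \<nu>)"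
    by simp
  then show ?thesis
    by (subst (asm) ennreal_le_iff[OF mmd_nonneg])
qed

lemma mmd_triangle:
  assumes "\<mu> \<in> borel_probs" "\<nu> \<in> borel_probs" "\<rho> \<in> borel_probs"
  shows "mmd K \<mu> \<rho> \<le> mmd K \<mu> \<nu> + mmd K \<nu> \<rho>"
proof (rule mmd_least)
  fix f assume f: "f \<in> unit_ball"
  show "\<bar>(\<integral>x. f x \<partial>\<mu>) - (\<integral>x. f x \<partial>\<rho>)\<bar> \<le> mmd K \<mu> \<nu> + mmd K \<nu> \<rho>"
    using mmd_upper[OF assms(1,2) f] mmd_upper[OF assms(2,3) f] by linarith
qed (simp add: mmd_nonneg)

lemma mmd_self: "mmd K \<mu> \<mu> = 0"
  using mmd_least[of \<mu> \<mu> 0] mmd_nonneg[of \<mu> \<mu>] by simp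

text \<open>The section of \<open>K\<close> at \<open>y\<close> has norm
  \<open>sqrt (K y y)\<close>; divided by it, the section is a member of the unit ball. If
  \<open>K y y = 0\<close>, the section vanishes identically.\<close>

lemma mmd_kernel:
  assumes "\<mu> \<in> borel_probs" "\<nu> \<in> borel_probs"
  shows "\<bar>(\<integral>x. K x y \<partial>\<mu>) - (\<integral>x. K x y \<partial>\<nu>)\<bar> \<le> sqrt C * mmd K \<mu> \<nu>"
proof (cases "K y y = 0")
  case True
  then have "(\<lambda>x. K x y) = (\<lambda>x. 0)"
    using rkhs_reproducing[OF is_rkhs rkhs_kernel_mem[OF is_rkhs], of y y]
    by (intro rkhs_ip_zero[OF is_rkhs rkhs_kernel_mem[OF is_rkhs]]) simp
  then have "K x y = 0" for x by (rule fun_cong)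
  moreover have "0 \<le> sqrt C * mmd K \<mu> \<nu>"
    using kernel_nonneg[of y] kernel_bound[of y] by (intro mult_nonneg_nonneg mmd_nonneg) simp
  ultimately show ?thesis by simp
next
  case False
  define a where "a = sqrt (K y y)"
  have a: "a > 0" "a \<le> sqrt C" "a * a = K y y"
    using False kernel_nonneg[of y] kernel_bound[of y] by (auto simp: a_def)
  note k = rkhs_kernel_mem[OF is_rkhs, of y]
  define f where "f = (\<lambda>x. inverse a * K x y)"
  have f: "f \<in> rkhs_space K" unfolding f_def by (rule rkhs_scale_mem[OF is_rkhs k])
  have "snd (rkhs K) f f = inverse a * snd (rkhs K) (\<lambda>x. K x y) f"
    using rkhs_ip_scale[OF is_rkhs k f, of "inverse a"] by (simp add: f_def)
  also have "\<dots> = inverse a * f y"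
    using rkhs_ip_sym[OF is_rkhs k f] rkhs_reproducing[OF is_rkhs f] by simp
  also have "\<dots> = 1" using a(1) by (simp add: f_def field_simps flip: a(3))
  finally have "f \<in> unit_ball" using f by (simp add: unit_ball_def rkhs_norm_def)
  from mmd_upper[OF assms this]
  have upper: "\<bar>(\<integral>x. f x \<partial>\<mu>) - (\<integral>x. f x \<partial>\<nu>)\<bar> \<le> mmd K \<mu> \<nu>" .
  have K_eq: "(\<integral>x. K x y \<partial>\<rho>) = a * (\<integral>x. f x \<partial>\<rho>)" for \<rho>
    using a(1) by (simp add: f_def)
  have "\<bar>(\<integral>x. K x y \<partial>\<mu>) - (\<integral>x. K x y \<partial>\<nu>)\<bar> = a * \<bar>(\<integral>x. f x \<partial>\<mu>) - (\<integral>x. f x \<partial>\<nu>)\<bar>"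
    using a(1) by (simp only: K_eq right_diff_distrib[symmetric] abs_mult abs_of_pos)
  also have "\<dots> \<le> a * mmd K \<mu> \<nu>"
    using a(1) upper by (intro mult_left_mono) simp_all
  also have "\<dots> \<le> sqrt C * mmd K \<mu> \<nu>"
    using a mmd_nonneg by (intro mult_right_mono)
  finally show ?thesis .
qed

end

section \<open>Tightness, separation of measures and transfer between test functions\<close>

lemma borel_probs_tight:
  fixes \<mu> :: "'a::euclidean_space measure"
  assumes "\<mu> \<in> borel_probs" "e > 0"
  obtains R where "R > 0" "measure \<mu> (cball 0 R) > 1 - e"
proof -
  interpret prob_space \<mu> using assms(1) by (rule borel_probs_prob_space)
  have "(\<lambda>n. measure \<mu> (cball 0 (real n))) \<longlonglongrightarrow> measure \<mu> (\<Union>n. cball 0 (real n))"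
    using assms(1) by (intro finite_Lim_measure_incseq) (auto simp: borel_probs_sets incseq_def)
  moreover have "(\<Union>n. cball (0::'a) (real n)) = UNIV"
    using real_arch_simple by auto
  ultimately have "(\<lambda>n. measure \<mu> (cball 0 (real n))) \<longlonglongrightarrow> 1"
    using prob_space borel_probs_space[OF assms(1)] by simp
  then have "\<forall>\<^sub>F n in sequentially. measure \<mu> (cball 0 (real n)) > 1 - e"
    using \<open>e > 0\<close> by (intro order_tendstoD(1)) auto
  then obtain n where "\<And>m. m \<ge> n \<Longrightarrow> measure \<mu> (cball 0 (real m)) > 1 - e"
    by (auto simp: eventually_sequentially)
  \<comment> \<open>The successor makes the radius positive.\<close>
  from this[of "Suc n"] show thesis by (intro that[of "real (Suc n)"]) auto
qed

text \<open>Closed sets form an intersection-stable generator, and the indicator of a nonempty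
  closed set is the pointwise limit of bounded continuous functions built from the distance to
  it.\<close>

lemma borel_probs_eqI:
  fixes \<mu> \<nu> :: "'a::metric_space measure"
  assumes \<mu>: "\<mu> \<in> borel_probs" and \<nu>: "\<nu> \<in> borel_probs"
    and eq: "\<And>f :: 'a \<Rightarrow> real. continuous_on UNIV f \<Longrightarrow> bounded (range f) \<Longrightarrow>
      (\<integral>x. f x \<partial>\<mu>) = (\<integral>x. f x \<partial>\<nu>)"
  shows "\<mu> = \<nu>"
proof -
  interpret M: prob_space \<mu> using \<mu> by (rule borel_probs_prob_space)
  interpret N: prob_space \<nu> using \<nu> by (rule borel_probs_prob_space)
  \<comment> \<open>The empty set is set apart: \<open>infdist\<close> to it is 0, so the
    approximants would be constantly 1.\<close>
  have closed_eq: "measure \<mu> S = measure \<nu> S" if S: "closed S" "S \<noteq> {}" for S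
  proof -
    define f where "f n x = max 0 (1 - real n * infdist x S)" for n x
    have cont: "continuous_on UNIV (f n)" for n
      unfolding f_def by (intro continuous_intros)
    have f01: "\<bar>f n x\<bar> \<le> 1" for n x
      by (simp add: f_def infdist_nonneg)
    have lim: "(\<lambda>n. f n x) \<longlonglongrightarrow> indicator S x" for x
    proof (cases "x \<in> S")
      case True
      then show ?thesis by (simp add: f_def)
    next
      case False
      then have "infdist x S > 0"
        using S infdist_pos_not_in_closed by blast
      then obtain N where N: "real N * infdist x S > 1"
        using reals_Archimedean3 by blast
      have "f n x = 0" if "n \<ge> N" for n
      proof -
        have "real N * infdist x S \<le> real n * infdist x S"
          using that by (intro mult_right_mono) (auto simp: infdist_nonneg)
        then show ?thesis using N by (simp add: f_def)
      qed
      then have "\<forall>\<^sub>F n in sequentially. f n x = indicator S x"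
        using False by (auto simp: eventually_sequentially)
      then show ?thesis by (rule tendsto_eventually)
    qed
    have conv: "(\<lambda>n. \<integral>x. f n x \<partial>\<rho>) \<longlonglongrightarrow> measure \<rho> S" if \<rho>: "\<rho> \<in> borel_probs" for \<rho> :: "'a measure"
    proof -
      interpret prob_space \<rho> using \<rho> by (rule borel_probs_prob_space)
      have "(\<lambda>n. \<integral>x. f n x \<partial>\<rho>) \<longlonglongrightarrow> (\<integral>x. indicator S x \<partial>\<rho>)"
      proof (rule integral_dominated_convergence[where w = "\<lambda>_. 1"])
        show "indicator S \<in> borel_measurable \<rho>"
          using S by (intro borel_probs_measurable_cong[OF \<rho>] borel_measurable_indicator borel_closed)
        show "f n \<in> borel_measurable \<rho>" for n
          by (rule borel_probs_measurable_cong[OF \<rho> borel_measurable_continuous_onI[OF cont]])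
      qed (use lim f01 in auto)
      then show ?thesis using S \<rho> by (simp add: borel_probs_sets borel_probs_space)
    qed
    have "bounded (range (f n))" for n
      using f01 by (auto simp: bounded_iff)
    then show ?thesis
      using LIMSEQ_unique[OF conv[OF \<mu>]] conv[OF \<nu>] eq[OF cont] by simp
  qed
  show ?thesis
  proof (rule measure_eqI_generator_eq[where E = "Collect closed" and \<Omega> = UNIV and A = "\<lambda>_. UNIV"])
    show "Int_stable (Collect closed :: 'a set set)"
      by (auto simp: Int_stable_def)
    show "emeasure \<mu> X = emeasure \<nu> X" if "X \<in> Collect closed" for X
      using closed_eq[of X] that by (cases "X = {}") (auto simp: M.emeasure_eq_measure N.emeasure_eq_measure)
    show "sets \<mu> = sigma_sets UNIV (Collect closed)" "sets \<nu> = sigma_sets UNIV (Collect closed)"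
      using \<mu> \<nu> by (simp_all add: borel_probs_sets borel_eq_closed)
  qed auto
qed

text \<open>A finite net \<open>X\<close> of a large ball carries functions \<open>\<phi> a\<close>,
  completed to a partition of unity by one function \<open>\<phi>0\<close> living outside the ball.
  Each \<open>f\<close> is close to its interpolation with coefficients \<open>f a\<close>, so the
  same finite \<open>G\<close> works for the whole family.\<close>

lemma weak_neighbourhood_equicontinuous:
  fixes \<mu> :: "'a::euclidean_space measure" and F :: "('a \<Rightarrow> real) set"
  assumes \<mu>: "\<mu> \<in> borel_probs" and "e > 0"
    and cont: "\<And>f. f \<in> F \<Longrightarrow> continuous_on UNIV f"
    and bound: "\<And>f x. f \<in> F \<Longrightarrow> \<bar>f x\<bar> \<le> M"
    and equi: "\<And>e. e > 0 \<Longrightarrow> \<exists>r>0. \<forall>f\<in>F. \<forall>x y. dist x y < r \<longrightarrow> \<bar>f x - f y\<bar> \<le> e"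
  shows "\<exists>(G :: ('a \<Rightarrow> real) set) \<delta>. finite G \<and> \<delta> > 0 \<and> (\<forall>g\<in>G. continuous_on UNIV g \<and> bounded (range g)) \<and>
    (\<forall>\<nu>\<in>borel_probs. (\<forall>g\<in>G. \<bar>(\<integral>x. g x \<partial>\<nu>) - (\<integral>x. g x \<partial>\<mu>)\<bar> < \<delta>) \<longrightarrow>
      (\<forall>f\<in>F. \<bar>(\<integral>x. f x \<partial>\<nu>) - (\<integral>x. f x \<partial>\<mu>)\<bar> \<le> (e :: real)))"
proof -
  interpret M: prob_space \<mu> using \<mu> by (rule borel_probs_prob_space)
  \<comment> \<open>If \<open>F\<close> is empty, \<open>M\<close> may be negative.\<close>
  define B where "B = \<bar>M\<bar>"
  have B: "B \<ge> 0" "\<And>f x. f \<in> F \<Longrightarrow> \<bar>f x\<bar> \<le> B"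
    using bound by (auto simp: B_def intro: order_trans[OF _ abs_ge_self])
  \<comment> \<open>The final estimate collects \<open>\<epsilon>\<close> from the interpolation
    under each of the two measures, and \<open>B * \<epsilon>\<close> four times: from the
    coefficients, from the tail of \<mu>, and twice from the tail of \<nu>.\<close>
  define \<epsilon> where "\<epsilon> = e / (2 + 4 * B)"
  have \<epsilon>: "\<epsilon> > 0" using B \<open>e > 0\<close> by (simp add: \<epsilon>_def)
  obtain r where r: "r > 0" "\<And>f x y. f \<in> F \<Longrightarrow> dist x y < r \<Longrightarrow> \<bar>f x - f y\<bar> \<le> \<epsilon>"
    using equi[OF \<epsilon>] by blast
  obtain R where R: "R > 0" "measure \<mu> (cball 0 R) > 1 - \<epsilon>"
    using borel_probs_tight[OF \<mu> \<epsilon>] .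
  have cover: "cball (0::'a) R \<subseteq> (\<Union>x\<in>UNIV. ball x r)"
    using r(1) centre_in_ball by blast
  obtain X where X: "finite X" "cball (0::'a) R \<subseteq> (\<Union>x\<in>X. ball x r)"
    by (rule compactE_image[OF _ _ cover]) auto
  \<comment> \<open>\<open>\<psi> a\<close> is positive exactly on the ball of radius
    \<open>r\<close> around \<open>a\<close>, and \<open>\<psi>0\<close> exactly outside the large
    ball. Together they are positive somewhere at each point, so their sum \<open>T\<close> can be
    divided out.\<close>
  define \<psi> where "\<psi> a x = max 0 (r - dist x a)" for a x :: 'a
  define \<psi>0 where "\<psi>0 x = max 0 (norm x - R)" for x :: 'a
  define T where "T x = (\<Sum>a\<in>X. \<psi> a x) + \<psi>0 x" for x
  have \<psi>_nonneg: "\<psi> a x \<ge> 0" "\<psi>0 x \<ge> 0" for a x by (auto simp: \<psi>_def \<psi>0_def)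
  have T: "T x > 0" for x
  proof (cases "x \<in> cball 0 R")
    case True
    then obtain a where a: "a \<in> X" "dist a x < r" using X by auto
    then have "\<psi> a x > 0" by (simp add: \<psi>_def dist_commute)
    then have "(\<Sum>a\<in>X. \<psi> a x) > 0"
      using X a \<psi>_nonneg by (intro sum_pos2[of X a]) auto
    then show ?thesis using \<psi>_nonneg(2)[of x] by (simp add: T_def)
  next
    case False
    then have "\<psi>0 x > 0" by (simp add: \<psi>0_def)
    then show ?thesis using \<psi>_nonneg(1) by (simp add: T_def add_nonneg_pos sum_nonneg)
  qed
  define \<phi> where "\<phi> a x = \<psi> a x / T x" for a x
  define \<phi>0 where "\<phi>0 x = \<psi>0 x / T x" for x
  have \<phi>_nonneg: "\<phi> a x \<ge> 0" "\<phi>0 x \<ge> 0" for a x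
    using \<psi>_nonneg T[of x] by (auto simp: \<phi>_def \<phi>0_def)
  have part: "(\<Sum>a\<in>X. \<phi> a x) + \<phi>0 x = 1" for x
    using T[of x] unfolding \<phi>_def \<phi>0_def
    by (simp flip: sum_divide_distrib add_divide_distrib T_def)
  have contT: "continuous_on UNIV T"
    unfolding T_def \<psi>_def \<psi>0_def by (intro continuous_intros)
  have T0: "T x \<noteq> 0" for x using T[of x] by simp
  have \<phi>_cont: "continuous_on UNIV (\<phi> a)" "continuous_on UNIV \<phi>0" for a
    unfolding \<phi>_def \<phi>0_def \<psi>_def \<psi>0_def using T0
    by (auto intro!: continuous_intros continuous_on_subset[OF contT])
  have \<phi>_le: "\<phi> a x \<le> 1" if "a \<in> X" for a x
    using part[of x] \<phi>_nonneg member_le_sum[OF that _ X(1), of "\<lambda>a. \<phi> a x"] by (smt (verit))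
  have \<phi>0_le: "\<phi>0 x \<le> 1" for x
    using part[of x] \<phi>_nonneg(1) sum_nonneg[of X "\<lambda>a. \<phi> a x"] by (smt (verit))
  have \<phi>_abs: "\<bar>\<phi> a x\<bar> \<le> 1" if "a \<in> X" for a x using \<phi>_le[OF that] \<phi>_nonneg by simp
  have \<phi>0_abs: "\<bar>\<phi>0 x\<bar> \<le> 1" for x using \<phi>0_le \<phi>_nonneg by simp
  define \<delta> where "\<delta> = \<epsilon> / (real (card X) + 1)"
  have \<delta>: "\<delta> > 0" "\<delta> \<le> \<epsilon>" "real (card X) * \<delta> \<le> \<epsilon>"
    using \<epsilon> by (auto simp: \<delta>_def field_simps)
  have int: "integrable \<nu> (\<phi> a)" "integrable \<nu> \<phi>0" if "a \<in> X" "\<nu> \<in> borel_probs" for a \<nu>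
    using that \<phi>_abs \<phi>0_abs
    by (auto intro!: borel_probs_integrable[where C = 1] borel_measurable_continuous_onI \<phi>_cont)
  have int0: "integrable \<nu> \<phi>0" if "\<nu> \<in> borel_probs" for \<nu>
    using that \<phi>0_abs
    by (auto intro!: borel_probs_integrable[where C = 1] borel_measurable_continuous_onI \<phi>_cont)
  \<comment> \<open>\<open>\<phi>0\<close> vanishes on the large ball and is at most 1, so its
    integral is at most the mass of \<mu> outside.\<close>
  have \<phi>0_\<mu>: "(\<integral>x. \<phi>0 x \<partial>\<mu>) \<le> \<epsilon>"
  proof -
    have ind: "integrable \<mu> (indicator (cball 0 R) :: 'a \<Rightarrow> real)"
      by (rule borel_probs_integrable[OF \<mu> borel_measurable_indicator, where C = 1])
        (auto simp: indicator_def)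
    have "(\<integral>x. \<phi>0 x \<partial>\<mu>) \<le> (\<integral>x. 1 - indicator (cball 0 R) x \<partial>\<mu>)"
    proof (rule integral_mono)
      show "integrable \<mu> (\<lambda>x. 1 - indicator (cball 0 R) x :: real)"
        using ind by simp
      show "\<phi>0 x \<le> 1 - indicator (cball 0 R) x" for x
        using \<phi>0_le[of x] by (cases "norm x \<le> R") (auto simp: \<phi>0_def \<psi>0_def)
    qed (use int0 \<mu> in auto)
    also have "\<dots> = 1 - measure \<mu> (cball 0 R)"
      using ind M.prob_space[unfolded borel_probs_space[OF \<mu>]] by (simp add: borel_probs_space[OF \<mu>])
    finally show ?thesis using R by simp
  qed
  show ?thesis
  proof (intro exI[of _ "insert \<phi>0 (\<phi> ` X)"] exI[of _ \<delta>] conjI ballI impI)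
    show "finite (insert \<phi>0 (\<phi> ` X))" using X by simp
    show "\<delta> > 0" by fact
    show "continuous_on UNIV g" if "g \<in> insert \<phi>0 (\<phi> ` X)" for g
      using that \<phi>_cont by auto
    show "bounded (range g)" if "g \<in> insert \<phi>0 (\<phi> ` X)" for g
    proof -
      have "\<bar>g x\<bar> \<le> 1" for x using that \<phi>_abs \<phi>0_abs by auto
      then show ?thesis by (intro boundedI[of _ 1]) auto
    qed
    fix \<nu> f
    assume \<nu>: "\<nu> \<in> borel_probs" and f: "f \<in> F"
      and close: "\<forall>g\<in>insert \<phi>0 (\<phi> ` X). \<bar>(\<integral>x. g x \<partial>\<nu>) - (\<integral>x. g x \<partial>\<mu>)\<bar> < \<delta>"
    have fm: "f \<in> borel_measurable borel" by (intro borel_measurable_continuous_onI cont f)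
    have pt: "\<bar>f x - (\<Sum>a\<in>X. f a * \<phi> a x)\<bar> \<le> \<epsilon> + B * \<phi>0 x" for x
    proof -
      have "f x - (\<Sum>a\<in>X. f a * \<phi> a x) = f x * ((\<Sum>a\<in>X. \<phi> a x) + \<phi>0 x) - (\<Sum>a\<in>X. f a * \<phi> a x)"
        by (simp add: part)
      also have "\<dots> = (\<Sum>a\<in>X. (f x - f a) * \<phi> a x) + f x * \<phi>0 x"
        by (simp add: distrib_left sum_distrib_left left_diff_distrib sum_subtractf)
      finally have eq: "f x - (\<Sum>a\<in>X. f a * \<phi> a x) = (\<Sum>a\<in>X. (f x - f a) * \<phi> a x) + f x * \<phi>0 x" .
      have sum_\<phi>: "(\<Sum>a\<in>X. \<phi> a x) = 1 - \<phi>0 x" using part[of x] by linarith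
      have "\<bar>\<Sum>a\<in>X. (f x - f a) * \<phi> a x\<bar> \<le> (\<Sum>a\<in>X. \<bar>(f x - f a) * \<phi> a x\<bar>)"
        by (rule sum_abs)
      also have "\<dots> \<le> (\<Sum>a\<in>X. \<epsilon> * \<phi> a x)"
      proof (rule sum_mono)
        \<comment> \<open>Where \<open>\<phi> a\<close> is nonzero, \<open>x\<close> lies within
          \<open>r\<close> of \<open>a\<close> and equicontinuity applies.\<close>
        fix a assume "a \<in> X"
        show "\<bar>(f x - f a) * \<phi> a x\<bar> \<le> \<epsilon> * \<phi> a x"
        proof (cases "dist x a < r")
          case True
          then show ?thesis using r(2)[OF f True] \<phi>_nonneg by (simp add: abs_mult mult_right_mono)
        next
          case False
          then show ?thesis by (simp add: \<phi>_def \<psi>_def)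
        qed
      qed
      also have "\<dots> = \<epsilon> * (1 - \<phi>0 x)"
        by (simp only: sum_distrib_left[symmetric] sum_\<phi>)
      also have "\<dots> \<le> \<epsilon>" using \<epsilon> \<phi>_nonneg by (simp add: mult_left_le)
      finally have 1: "\<bar>\<Sum>a\<in>X. (f x - f a) * \<phi> a x\<bar> \<le> \<epsilon>" .
      have 2: "\<bar>f x * \<phi>0 x\<bar> \<le> B * \<phi>0 x"
        using B(2)[OF f] \<phi>_nonneg by (simp add: abs_mult mult_right_mono)
      show ?thesis unfolding eq using 1 2 by linarith
    qed
    have approx: "\<bar>(\<integral>x. f x \<partial>\<rho>) - (\<Sum>a\<in>X. f a * (\<integral>x. \<phi> a x \<partial>\<rho>))\<bar> \<le> \<epsilon> + B * (\<integral>x. \<phi>0 x \<partial>\<rho>)"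
      if \<rho>: "\<rho> \<in> borel_probs" for \<rho>
    proof -
      interpret P: prob_space \<rho> using \<rho> by (rule borel_probs_prob_space)
      have fi: "integrable \<rho> f"
        using B(2)[OF f] by (intro borel_probs_integrable[OF \<rho> fm]) simp
      have si: "integrable \<rho> (\<lambda>x. \<Sum>a\<in>X. f a * \<phi> a x)"
        using int(1)[OF _ \<rho>] by auto
      have "(\<integral>x. f x \<partial>\<rho>) - (\<Sum>a\<in>X. f a * (\<integral>x. \<phi> a x \<partial>\<rho>)) = (\<integral>x. f x - (\<Sum>a\<in>X. f a * \<phi> a x) \<partial>\<rho>)"
        using fi si int(1)[OF _ \<rho>] by (simp add: Bochner_Integration.integral_sum)
      then have "\<bar>(\<integral>x. f x \<partial>\<rho>) - (\<Sum>a\<in>X. f a * (\<integral>x. \<phi> a x \<partial>\<rho>))\<bar> \<le>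
          (\<integral>x. \<bar>f x - (\<Sum>a\<in>X. f a * \<phi> a x)\<bar> \<partial>\<rho>)"
        by (simp only: integral_abs_bound)
      also have "\<dots> \<le> (\<integral>x. \<epsilon> + B * \<phi>0 x \<partial>\<rho>)"
        using fi si int0[OF \<rho>] pt by (intro integral_mono) auto
      also have "\<dots> = \<epsilon> + B * (\<integral>x. \<phi>0 x \<partial>\<rho>)"
        using int0[OF \<rho>] by (simp add: P.prob_space)
      finally show ?thesis .
    qed
    have "\<bar>(\<Sum>a\<in>X. f a * (\<integral>x. \<phi> a x \<partial>\<nu>)) - (\<Sum>a\<in>X. f a * (\<integral>x. \<phi> a x \<partial>\<mu>))\<bar> \<le>
      (\<Sum>a\<in>X. \<bar>f a * ((\<integral>x. \<phi> a x \<partial>\<nu>) - (\<integral>x. \<phi> a x \<partial>\<mu>))\<bar>)"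
      by (simp add: right_diff_distrib flip: sum_subtractf)
    also have "\<dots> \<le> (\<Sum>a\<in>X. B * \<delta>)"
      unfolding abs_mult using B(1) B(2)[OF f] close by (intro sum_mono mult_mono) (auto simp: less_imp_le)
    also have "\<dots> = B * (real (card X) * \<delta>)" by simp
    also have "\<dots> \<le> B * \<epsilon>" using \<delta> B(1) by (intro mult_left_mono)
    finally have mid: "\<bar>(\<Sum>a\<in>X. f a * (\<integral>x. \<phi> a x \<partial>\<nu>)) - (\<Sum>a\<in>X. f a * (\<integral>x. \<phi> a x \<partial>\<mu>))\<bar> \<le> B * \<epsilon>" .
    \<comment> \<open>Since \<open>\<phi>0\<close> belongs to \<open>G\<close>, the tail bound
      passes from \<mu> to \<nu>: the mass of \<nu> is controlled with the radius chosen for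
      \<mu>.\<close>
    have "(\<integral>x. \<phi>0 x \<partial>\<nu>) \<le> 2 * \<epsilon>"
      using bspec[OF close insertI1] \<phi>0_\<mu> \<delta> by linarith
    then have "B * (\<integral>x. \<phi>0 x \<partial>\<nu>) \<le> B * (2 * \<epsilon>)"
      using B(1) by (rule mult_left_mono)
    moreover have "B * (\<integral>x. \<phi>0 x \<partial>\<mu>) \<le> B * \<epsilon>"
      using \<phi>0_\<mu> B(1) by (rule mult_left_mono)
    ultimately have "\<bar>(\<integral>x. f x \<partial>\<nu>) - (\<integral>x. f x \<partial>\<mu>)\<bar> \<le> 2 * \<epsilon> + 4 * (B * \<epsilon>)"
      using approx[OF \<mu>] approx[OF \<nu>] mid by linarith
    also have "\<dots> = (2 + 4 * B) * \<epsilon>" by (simp add: algebra_simps)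
    also have "\<dots> = e" using B(1) by (simp add: \<epsilon>_def)
    finally show "\<bar>(\<integral>x. f x \<partial>\<nu>) - (\<integral>x. f x \<partial>\<mu>)\<bar> \<le> e" .
  qed
qed

text \<open>If no threshold worked, there would be counterexamples \<open>h n\<close> with weighted
  energy at most \<open>1 / Suc n\<close>. Along a subsequence \<open>w x * (h n x)\<^sup>2\<close>
  tends to 0 almost everywhere, hence so does \<open>h n x\<close> because \<open>w x > 0\<close>,
  and dominated convergence contradicts the lower bound \<open>e\<close>. The uniform bound
  \<open>B\<close> provides the majorant \<open>g x * B\<close>.\<close>

lemma weighted_L2_small_imp_L1_small:
  fixes w g :: "'a \<Rightarrow> real"
  assumes w: "integrable M w" "\<And>x. w x > 0" and g: "integrable M g" "\<And>x. g x \<ge> 0" and "e > 0"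
  shows "\<exists>\<delta>>0. \<forall>h\<in>borel_measurable M. (\<forall>x. 0 \<le> h x \<and> h x \<le> B) \<longrightarrow>
    (\<integral>x. w x * (h x)\<^sup>2 \<partial>M) \<le> \<delta> \<longrightarrow> (\<integral>x. g x * h x \<partial>M) \<le> (e :: real)"
    (is ?claim)
proof (rule ccontr)
  assume neg: "\<not> ?claim"
  define Q where "Q \<delta> h \<longleftrightarrow> h \<in> borel_measurable M \<and> (\<forall>x. 0 \<le> h x \<and> h x \<le> B) \<and>
      (\<integral>x. w x * (h x)\<^sup>2 \<partial>M) \<le> \<delta> \<and> \<not> (\<integral>x. g x * h x \<partial>M) \<le> e" for \<delta> :: real and h
  have "\<exists>h. Q (inverse (real (Suc n))) h" for n
  proof (rule ccontr)
    assume "\<nexists>h. Q (inverse (real (Suc n))) h"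
    then have ?claim unfolding Q_def by (intro exI[of _ "inverse (real (Suc n))"]) auto
    with neg show False by contradiction
  qed
  then obtain h where "\<And>n. Q (inverse (real (Suc n))) (h n)" by metis
  then have h[measurable]: "h n \<in> borel_measurable M" and h01: "0 \<le> h n x" "h n x \<le> B"
    and small: "(\<integral>x. w x * (h n x)\<^sup>2 \<partial>M) \<le> inverse (real (Suc n))"
    and big: "\<not> (\<integral>x. g x * h n x \<partial>M) \<le> e" for n x
    by (auto simp: Q_def)
  have [measurable]: "w \<in> borel_measurable M" "g \<in> borel_measurable M" using w g by auto
  have "integrable M (\<lambda>x. w x * (h n x)\<^sup>2)" for n
  proof (rule Bochner_Integration.integrable_bound)
    show "integrable M (\<lambda>x. w x * B\<^sup>2)" using w(1) by (rule integrable_mult_left)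
    show "AE x in M. norm (w x * (h n x)\<^sup>2) \<le> norm (w x * B\<^sup>2)"
      using h01 by (intro AE_I2) (simp add: abs_mult mult_left_mono power_mono)
  qed measurable
  moreover have "(\<lambda>n. \<integral>x. norm (w x * (h n x)\<^sup>2) \<partial>M) \<longlonglongrightarrow> 0"
  proof (rule tendsto_sandwich[OF _ _ tendsto_const LIMSEQ_inverse_real_of_nat])
    show "\<forall>\<^sub>F n in sequentially. (\<integral>x. norm (w x * (h n x)\<^sup>2) \<partial>M) \<le> inverse (real (Suc n))"
      using small w(2) by (intro always_eventually allI) (simp add: abs_mult less_imp_le)
  qed simp
  ultimately obtain r where r: "strict_mono r" "AE x in M. (\<lambda>n. w x * (h (r n) x)\<^sup>2) \<longlonglongrightarrow> 0"
    using tendsto_L1_AE_subseq[of M "\<lambda>n x. w x * (h n x)\<^sup>2"] by blast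
  have "(\<lambda>n. \<integral>x. g x * h (r n) x \<partial>M) \<longlonglongrightarrow> (\<integral>x. 0 \<partial>M)"
  proof (rule integral_dominated_convergence[where w = "\<lambda>x. g x * B"])
    show "integrable M (\<lambda>x. g x * B)" using g(1) by (rule integrable_mult_left)
    show "AE x in M. norm (g x * h (r n) x) \<le> g x * B" for n
      using g(2) h01 by (intro AE_I2) (simp add: abs_mult mult_left_mono)
    show "AE x in M. (\<lambda>n. g x * h (r n) x) \<longlonglongrightarrow> 0"
      using r(2)
    proof eventually_elim
      case (elim x)
      \<comment> \<open>Dividing by \<open>w x\<close> and taking the root recovers
        \<open>h (r n) x\<close> itself because it is nonnegative.\<close>
      have "(\<lambda>n. sqrt (w x * (h (r n) x)\<^sup>2 / w x)) \<longlonglongrightarrow> sqrt (0 / w x)"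
        using w(2)[of x] by (intro tendsto_intros elim) simp
      then have "(\<lambda>n. h (r n) x) \<longlonglongrightarrow> 0"
        using w(2)[of x] h01 by simp
      from tendsto_mult_left[OF this, of "g x"] show ?case by simp
    qed
  qed measurable
  then have "\<forall>\<^sub>F n in sequentially. (\<integral>x. g x * h (r n) x \<partial>M) < e"
    using \<open>e > 0\<close> by (intro order_tendstoD(2)) auto
  then obtain n where "(\<integral>x. g x * h (r n) x \<partial>M) < e"
    by (auto simp: eventually_sequentially)
  with big[of "r n"] show False by simp
qed

text \<open>\<open>D \<nu>\<close> stands for the discrepancy from \<mu>. The cutoff
  \<open>\<kappa>\<close> is itself a compactly supported test function and all measures have mass
  1, so closeness of its integrals bounds the mass that \<nu> places far away.\<close>

lemma vague_imp_weak:
  fixes \<mu> :: "'a::euclidean_space measure" and D :: "'a measure \<Rightarrow> real"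
  assumes \<mu>: "\<mu> \<in> borel_probs"
    and vague: "\<And>(f :: 'a \<Rightarrow> real) R e. continuous_on UNIV f \<Longrightarrow> (\<And>x. x \<notin> cball 0 R \<Longrightarrow> f x = 0) \<Longrightarrow> e > 0 \<Longrightarrow>
      \<exists>\<delta>>0. \<forall>\<nu>\<in>borel_probs. D \<nu> < \<delta> \<longrightarrow> \<bar>(\<integral>x. f x \<partial>\<nu>) - (\<integral>x. f x \<partial>\<mu>)\<bar> < e"
    and f: "continuous_on UNIV f" "bounded (range f)" and "e > 0"
  shows "\<exists>\<delta>>0. \<forall>\<nu>\<in>borel_probs. D \<nu> < \<delta> \<longrightarrow> \<bar>(\<integral>x. f x \<partial>\<nu>) - (\<integral>x. f x \<partial>\<mu>)\<bar> < (e :: real)"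
proof -
  interpret M: prob_space \<mu> using \<mu> by (rule borel_probs_prob_space)
  obtain B where B: "B > 0" "\<And>x. \<bar>f x\<bar> \<le> B"
    using f(2) unfolding bounded_pos by auto
  \<comment> \<open>One \<open>\<epsilon>\<close> for the test function
    \<open>f x * \<kappa> x\<close>, and \<open>B * \<epsilon>\<close> three times for cutting off:
    once under \<mu> and twice under \<nu>.\<close>
  define \<epsilon> where "\<epsilon> = e / (1 + 3 * B)"
  have \<epsilon>: "\<epsilon> > 0" using B(1) \<open>e > 0\<close> by (simp add: \<epsilon>_def)
  obtain R where R: "R > 0" "measure \<mu> (cball 0 R) > 1 - \<epsilon>"
    using borel_probs_tight[OF \<mu> \<epsilon>] .
  define \<kappa> where "\<kappa> x = max 0 (min 1 (R + 1 - norm x))" for x :: 'a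
  have \<kappa>_cont: "continuous_on UNIV \<kappa>" unfolding \<kappa>_def by (intro continuous_intros)
  have \<kappa>01: "0 \<le> \<kappa> x" "\<kappa> x \<le> 1" for x by (auto simp: \<kappa>_def)
  have \<kappa>_supp: "\<kappa> x = 0" if "x \<notin> cball 0 (R + 1)" for x using that by (simp add: \<kappa>_def)
  have \<kappa>m: "\<kappa> \<in> borel_measurable borel" and fm: "f \<in> borel_measurable borel"
    and f\<kappa>m: "(\<lambda>x. f x * \<kappa> x) \<in> borel_measurable borel"
    using f(1) \<kappa>_cont by (auto intro!: borel_measurable_continuous_onI continuous_intros)
  have \<kappa>_int: "integrable \<rho> \<kappa>" if "\<rho> \<in> borel_probs" for \<rho>
    using \<kappa>01 by (intro borel_probs_integrable[OF that \<kappa>m, of 1]) simp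
  have f_int: "integrable \<rho> f" if "\<rho> \<in> borel_probs" for \<rho>
    using B(2) by (intro borel_probs_integrable[OF that fm, of B]) simp
  have f\<kappa>_le: "\<bar>f x * \<kappa> x\<bar> \<le> B" for x
    using mult_mono[OF B(2)[of x] \<kappa>01(2)[of x]] B(1) \<kappa>01(1)[of x] by (simp add: abs_mult)
  have f\<kappa>_int: "integrable \<rho> (\<lambda>x. f x * \<kappa> x)" if "\<rho> \<in> borel_probs" for \<rho>
    using f\<kappa>_le by (intro borel_probs_integrable[OF that f\<kappa>m, of B]) simp
  obtain \<delta>1 where \<delta>1: "\<delta>1 > 0"
    "\<And>\<nu>. \<nu> \<in> borel_probs \<Longrightarrow> D \<nu> < \<delta>1 \<Longrightarrow> \<bar>(\<integral>x. \<kappa> x \<partial>\<nu>) - (\<integral>x. \<kappa> x \<partial>\<mu>)\<bar> < \<epsilon>"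
    using vague[OF \<kappa>_cont \<kappa>_supp \<epsilon>] by blast
  have "continuous_on UNIV (\<lambda>x. f x * \<kappa> x)" by (intro continuous_intros f(1) \<kappa>_cont)
  then obtain \<delta>2 where \<delta>2: "\<delta>2 > 0"
    "\<And>\<nu>. \<nu> \<in> borel_probs \<Longrightarrow> D \<nu> < \<delta>2 \<Longrightarrow> \<bar>(\<integral>x. f x * \<kappa> x \<partial>\<nu>) - (\<integral>x. f x * \<kappa> x \<partial>\<mu>)\<bar> < \<epsilon>"
    using vague[of "\<lambda>x. f x * \<kappa> x" "R + 1" \<epsilon>] \<kappa>_supp \<epsilon> by auto
  have cut: "\<bar>(\<integral>x. f x \<partial>\<rho>) - (\<integral>x. f x * \<kappa> x \<partial>\<rho>)\<bar> \<le> B * (1 - (\<integral>x. \<kappa> x \<partial>\<rho>))" if \<rho>: "\<rho> \<in> borel_probs" for \<rho>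
  proof -
    interpret P: prob_space \<rho> using \<rho> by (rule borel_probs_prob_space)
    have "(\<integral>x. f x \<partial>\<rho>) - (\<integral>x. f x * \<kappa> x \<partial>\<rho>) = (\<integral>x. f x - f x * \<kappa> x \<partial>\<rho>)"
      using f_int[OF \<rho>] f\<kappa>_int[OF \<rho>] by simp
    then have "\<bar>(\<integral>x. f x \<partial>\<rho>) - (\<integral>x. f x * \<kappa> x \<partial>\<rho>)\<bar> \<le> (\<integral>x. \<bar>f x - f x * \<kappa> x\<bar> \<partial>\<rho>)"
      by (simp only: integral_abs_bound)
    also have "\<dots> \<le> (\<integral>x. B * (1 - \<kappa> x) \<partial>\<rho>)"
    proof (rule integral_mono)
      fix x
      have "\<bar>f x - f x * \<kappa> x\<bar> = \<bar>f x\<bar> * (1 - \<kappa> x)"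
        using \<kappa>01[of x] abs_mult[of "f x" "1 - \<kappa> x"] by (simp add: right_diff_distrib)
      then show "\<bar>f x - f x * \<kappa> x\<bar> \<le> B * (1 - \<kappa> x)"
        using B(2)[of x] \<kappa>01(2)[of x] by (simp add: mult_right_mono)
    qed (use f_int[OF \<rho>] f\<kappa>_int[OF \<rho>] \<kappa>_int[OF \<rho>] in auto)
    also have "\<dots> = B * (1 - (\<integral>x. \<kappa> x \<partial>\<rho>))"
      using \<kappa>_int[OF \<rho>] P.prob_space by simp
    finally show ?thesis .
  qed
  have "measure \<mu> (cball 0 R) \<le> (\<integral>x. \<kappa> x \<partial>\<mu>)"
  proof -
    have ind: "integrable \<mu> (indicator (cball 0 R) :: 'a \<Rightarrow> real)"
      by (rule borel_probs_integrable[OF \<mu> borel_measurable_indicator, where C = 1])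
        (auto simp: indicator_def)
    have "(\<integral>x. indicator (cball 0 R) x \<partial>\<mu>) \<le> (\<integral>x. \<kappa> x \<partial>\<mu>)"
    proof (rule integral_mono[OF ind \<kappa>_int[OF \<mu>]])
      show "indicator (cball 0 R) x \<le> \<kappa> x" for x by (auto simp: indicator_def \<kappa>_def)
    qed
    then show ?thesis by (simp add: borel_probs_space[OF \<mu>])
  qed
  then have \<mu>\<kappa>: "1 - (\<integral>x. \<kappa> x \<partial>\<mu>) \<le> \<epsilon>" using R(2) by simp
  have "\<bar>(\<integral>x. f x \<partial>\<nu>) - (\<integral>x. f x \<partial>\<mu>)\<bar> < e" if \<nu>: "\<nu> \<in> borel_probs" "D \<nu> < min \<delta>1 \<delta>2" for \<nu>
  proof -
    have 1: "\<bar>(\<integral>x. \<kappa> x \<partial>\<nu>) - (\<integral>x. \<kappa> x \<partial>\<mu>)\<bar> < \<epsilon>"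
      and 2: "\<bar>(\<integral>x. f x * \<kappa> x \<partial>\<nu>) - (\<integral>x. f x * \<kappa> x \<partial>\<mu>)\<bar> < \<epsilon>"
      using \<delta>1(2) \<delta>2(2) \<nu> by auto
    have "B * (1 - (\<integral>x. \<kappa> x \<partial>\<nu>)) \<le> B * (2 * \<epsilon>)" "B * (1 - (\<integral>x. \<kappa> x \<partial>\<mu>)) \<le> B * \<epsilon>"
      using 1 \<mu>\<kappa> B(1) by (intro mult_left_mono; simp)+
    then have "\<bar>(\<integral>x. f x \<partial>\<nu>) - (\<integral>x. f x \<partial>\<mu>)\<bar> < \<epsilon> + 3 * (B * \<epsilon>)"
      using cut[OF \<nu>(1)] cut[OF \<mu>] 2 by linarith
    also have "\<dots> = (1 + 3 * B) * \<epsilon>" by (simp add: algebra_simps)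
    also have "\<dots> = e" using B(1) by (simp add: \<epsilon>_def)
    finally show ?thesis .
  qed
  then show ?thesis using \<delta>1(1) \<delta>2(1) by (intro exI[of _ "min \<delta>1 \<delta>2"]) auto
qed

section \<open>Kernels with positive Fourier transform\<close>

definition cf :: "'a::euclidean_space measure \<Rightarrow> 'a \<Rightarrow> complex" where
  "cf \<rho> \<xi> = (\<integral>x. cis (\<xi> \<bullet> x) \<partial>\<rho>)"

lemma norm_cf_le:
  assumes "\<rho> \<in> borel_probs"
  shows "norm (cf \<rho> \<xi>) \<le> 1"
  unfolding cf_def by (rule borel_probs_integral_bound[OF assms]) auto

lemma borel_measurable_cf:
  assumes "\<rho> \<in> borel_probs"
  shows "cf \<rho> \<in> borel_measurable borel"
proof -
  interpret prob_space \<rho> using assms by (rule borel_probs_prob_space)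
  have [measurable_cong]: "sets \<rho> = sets borel" using assms by (rule borel_probs_sets)
  show ?thesis unfolding cf_def by measurable
qed

text \<open>Brings the conjugate into the form that \<open>cf_Fubini\<close> produces for
  \<open>T x = - x\<close>.\<close>

lemma cnj_cf: "cnj (cf \<rho> \<xi>) = (\<integral>x. cis (\<xi> \<bullet> (- x)) \<partial>\<rho>)"
proof -
  have "cnj (cf \<rho> \<xi>) = (\<integral>x. cnj (cis (\<xi> \<bullet> x)) \<partial>\<rho>)"
    unfolding cf_def by (rule Bochner_Integration.integral_cnj[symmetric])
  then show ?thesis by (simp only: cis_cnj inner_minus_right)
qed

lemma borel_measurable_cnj_cf:
  assumes "\<rho> \<in> borel_probs"
  shows "(\<lambda>\<xi>. cnj (cf \<rho> \<xi>)) \<in> borel_measurable borel"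
proof (rule measurable_compose[OF borel_measurable_cf[OF assms]])
  show "cnj \<in> borel_measurable borel"
    by (intro borel_measurable_continuous_onI continuous_on_cnj continuous_on_id)
qed

lemma cf_Fubini:
  fixes g :: "'a::euclidean_space \<Rightarrow> complex"
  assumes \<rho>: "\<rho> \<in> borel_probs" and g: "integrable lborel g" and T: "T \<in> borel_measurable borel"
  shows "(\<integral>x. (\<integral>\<xi>. g \<xi> * cis (\<xi> \<bullet> T x) \<partial>lborel) \<partial>\<rho>) = (\<integral>\<xi>. g \<xi> * (\<integral>x. cis (\<xi> \<bullet> T x) \<partial>\<rho>) \<partial>lborel)"
proof -
  interpret prob_space \<rho> using \<rho> by (rule borel_probs_prob_space)
  show ?thesis
    using fourier_Fubini[OF sigma_finite_measure_axioms, of "\<lambda>_. 1" g T]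
      g borel_probs_measurable_cong[OF \<rho> T] by simp
qed

lemma integrable_mult_bounded:
  fixes g b :: "'a \<Rightarrow> complex"
  assumes g: "integrable M g" and [measurable]: "b \<in> borel_measurable M" and b: "\<And>x. norm (b x) \<le> C"
  shows "integrable M (\<lambda>x. g x * b x)"
proof (rule Bochner_Integration.integrable_bound)
  have [measurable]: "g \<in> borel_measurable M" using g by auto
  show "integrable M (\<lambda>x. norm (g x) * C)" using g by (intro integrable_mult_left integrable_norm)
  have "norm (g x * b x) \<le> norm (norm (g x) * C)" for x
  proof -
    have "norm (g x) * norm (b x) \<le> norm (g x) * \<bar>C\<bar>"
      using b[of x] by (intro mult_left_mono) auto
    then show ?thesis by (simp add: norm_mult abs_mult)
  qed
  then show "AE x in M. norm (g x * b x) \<le> norm (norm (g x) * C)" by simp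
  show "(\<lambda>x. g x * b x) \<in> borel_measurable M" by measurable
qed

text \<open>By Fubini, integrating \<open>F\<close> against a measure amounts to integrating
  \<open>g\<close> against its characteristic function and taking the real part, so the difference
  depends on the two measures through \<open>cf \<mu> - cf \<nu>\<close>.\<close>

lemma fourier_integral_diff_bound:
  fixes g :: "'a::euclidean_space \<Rightarrow> complex"
  defines "F \<equiv> \<lambda>x. Re (\<integral>\<xi>. g \<xi> * cis (\<xi> \<bullet> x) \<partial>lborel)"
  assumes \<mu>: "\<mu> \<in> borel_probs" and \<nu>: "\<nu> \<in> borel_probs" and g: "integrable lborel g"
  shows "integrable \<mu> F"
    and "\<bar>(\<integral>x. F x \<partial>\<nu>) - (\<integral>x. F x \<partial>\<mu>)\<bar> \<le> (\<integral>\<xi>. norm (g \<xi>) * norm (cf \<mu> \<xi> - cf \<nu> \<xi>) \<partial>lborel)"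
proof -
  have [measurable]: "g \<in> borel_measurable borel" using g by (auto dest: borel_measurable_integrable)
  let ?G = "\<lambda>x. \<integral>\<xi>. g \<xi> * cis (\<xi> \<bullet> x) \<partial>lborel"
  have "?G \<in> borel_measurable borel" by measurable
  moreover have "norm (?G x) \<le> (\<integral>\<xi>. norm (g \<xi>) \<partial>lborel)" for x
    using integral_norm_bound[of lborel "\<lambda>\<xi>. g \<xi> * cis (\<xi> \<bullet> x)"] by (simp add: norm_mult)
  ultimately have G: "integrable \<rho> ?G" if "\<rho> \<in> borel_probs" for \<rho>
    using that by (intro borel_probs_integrable)
  then show "integrable \<mu> F" unfolding F_def using \<mu> by (intro integrable_Re) auto
  have F: "(\<integral>x. F x \<partial>\<rho>) = Re (\<integral>\<xi>. g \<xi> * cf \<rho> \<xi> \<partial>lborel)" if "\<rho> \<in> borel_probs" for \<rho>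
    using cf_Fubini[OF that g, of "\<lambda>x. x"] by (simp add: F_def integral_Re[OF G[OF that]] cf_def)
  have i: "integrable lborel (\<lambda>\<xi>. g \<xi> * cf \<rho> \<xi>)" if "\<rho> \<in> borel_probs" for \<rho>
    by (rule integrable_mult_bounded[OF g _ norm_cf_le[OF that]]) (simp add: borel_measurable_cf that)
  have "(\<integral>x. F x \<partial>\<mu>) - (\<integral>x. F x \<partial>\<nu>) = Re (\<integral>\<xi>. g \<xi> * (cf \<mu> \<xi> - cf \<nu> \<xi>) \<partial>lborel)"
    using i[OF \<mu>] i[OF \<nu>] by (simp add: F \<mu> \<nu> right_diff_distrib)
  then have "\<bar>(\<integral>x. F x \<partial>\<nu>) - (\<integral>x. F x \<partial>\<mu>)\<bar> \<le> norm (\<integral>\<xi>. g \<xi> * (cf \<mu> \<xi> - cf \<nu> \<xi>) \<partial>lborel)"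
    using abs_Re_le_cmod by (simp add: abs_minus_commute)
  also have "\<dots> \<le> (\<integral>\<xi>. norm (g \<xi> * (cf \<mu> \<xi> - cf \<nu> \<xi>)) \<partial>lborel)"
    by (rule integral_norm_bound)
  finally show "\<bar>(\<integral>x. F x \<partial>\<nu>) - (\<integral>x. F x \<partial>\<mu>)\<bar> \<le> (\<integral>\<xi>. norm (g \<xi>) * norm (cf \<mu> \<xi> - cf \<nu> \<xi>) \<partial>lborel)"
    by (simp only: norm_mult)
qed

section \<open>Translation-invariant kernels: function space and control of the discrepancy\<close>

locale fourier_kernel =
  fixes K :: "'a::euclidean_space \<Rightarrow> 'a \<Rightarrow> real" and \<Phi> :: "'a \<Rightarrow> real" and w :: "'a \<Rightarrow> real" and c :: real
  assumes K_eq: "K x y = \<Phi> (x - y)"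
    and continuous_\<Phi>: "continuous_on UNIV \<Phi>"
    and w_pos: "w \<xi> > 0" and w_int: "integrable lborel w"
    and c_pos: "c > 0"
    and \<Phi>_fourier: "complex_of_real (\<Phi> x) = (\<integral>\<xi>. complex_of_real (w \<xi>) * cis (\<xi> \<bullet> x) \<partial>lborel) / complex_of_real c"
begin

lemma w_measurable [measurable]: "w \<in> borel_measurable borel"
  using w_int by (auto dest: borel_measurable_integrable)

lemma w_cis_integrable: "integrable lborel (\<lambda>\<xi>. complex_of_real (w \<xi>) * cis (\<xi> \<bullet> x))"
  using w_int by (intro integrable_mult_bounded[where C = 1]) (auto simp: complex_of_real_integrable_eq)

text \<open>On complex numbers \<open>\<bullet>\<close> is the real part of the Hermitian product,
  so this is the real L2 product with density \<open>w / c\<close>. Bounded continuous functions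
  serve as carrier: they form a real vector space, contain the characters, and have finite integrals
  against the integrable \<open>w\<close>.\<close>

definition weighted_ip :: "('a \<Rightarrow>\<^sub>C complex) \<Rightarrow> ('a \<Rightarrow>\<^sub>C complex) \<Rightarrow> real" where
  "weighted_ip u v = (\<integral>\<xi>. w \<xi> * (apply_bcontfun u \<xi> \<bullet> apply_bcontfun v \<xi>) \<partial>lborel) / c"

definition character :: "'a \<Rightarrow> 'a \<Rightarrow>\<^sub>C complex" where
  "character x = Bcontfun (\<lambda>\<xi>. cis (\<xi> \<bullet> x))"

lemma apply_character: "apply_bcontfun (character x) \<xi> = cis (\<xi> \<bullet> x)"
  unfolding character_def
  by (subst Bcontfun_inverse) (auto intro!: bcontfun_normI[where b = 1] continuous_intros)

lemma weighted_ip_integrable: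
  "integrable lborel (\<lambda>\<xi>. w \<xi> * (apply_bcontfun u \<xi> \<bullet> apply_bcontfun v \<xi>))"
proof (rule Bochner_Integration.integrable_bound)
  have [measurable]: "(\<lambda>\<xi>. apply_bcontfun u \<xi> \<bullet> apply_bcontfun v \<xi>) \<in> borel_measurable borel"
    by (intro borel_measurable_continuous_onI continuous_on_inner continuous_on_apply_bcontfun)
  show "integrable lborel (\<lambda>\<xi>. w \<xi> * (norm u * norm v))" using w_int by (rule integrable_mult_left)
  show "(\<lambda>\<xi>. w \<xi> * (apply_bcontfun u \<xi> \<bullet> apply_bcontfun v \<xi>)) \<in> borel_measurable lborel" by measurable
  have "norm (w \<xi> * (apply_bcontfun u \<xi> \<bullet> apply_bcontfun v \<xi>)) \<le> norm (w \<xi> * (norm u * norm v))" for \<xi>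
  proof -
    have "\<bar>apply_bcontfun u \<xi> \<bullet> apply_bcontfun v \<xi>\<bar> \<le> norm (apply_bcontfun u \<xi>) * norm (apply_bcontfun v \<xi>)"
      by (rule Cauchy_Schwarz_ineq2)
    also have "\<dots> \<le> norm u * norm v"
      by (intro mult_mono norm_bounded) auto
    finally show ?thesis by (simp add: abs_mult mult_left_mono)
  qed
  then show "AE \<xi> in lborel. norm (w \<xi> * (apply_bcontfun u \<xi> \<bullet> apply_bcontfun v \<xi>)) \<le> norm (w \<xi> * (norm u * norm v))"
    by simp
qed

text \<open>The inversion formula read as a Gram matrix of characters.\<close>

lemma weighted_ip_character: "weighted_ip (character x) (character y) = \<Phi> (x - y)"
proof -
  have "w \<xi> * (apply_bcontfun (character x) \<xi> \<bullet> apply_bcontfun (character y) \<xi>) =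
      Re (complex_of_real (w \<xi>) * cis (\<xi> \<bullet> (x - y)))" for \<xi>
    by (simp add: apply_character inner_complex_def inner_diff_right cos_diff)
  then have "weighted_ip (character x) (character y) =
      Re (\<integral>\<xi>. complex_of_real (w \<xi>) * cis (\<xi> \<bullet> (x - y)) \<partial>lborel) / c"
    by (simp only: weighted_ip_def integral_Re[OF w_cis_integrable])
  also have "\<dots> = Re (complex_of_real (\<Phi> (x - y)))"
    unfolding \<Phi>_fourier by simp
  finally show ?thesis by simp
qed

text \<open>Symmetry of \<open>weighted_ip\<close> at the characters of \<open>0\<close> and
  \<open>x\<close>.\<close>

lemma \<Phi>_uminus: "\<Phi> (- x) = \<Phi> x"
  using weighted_ip_character[of 0 x] weighted_ip_character[of x 0]
  by (simp add: weighted_ip_def inner_commute)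

lemma semi_inner_weighted_ip: "semi_inner weighted_ip"
proof
  fix u v x :: "'a \<Rightarrow>\<^sub>C complex" and r :: real
  show "weighted_ip (u + v) x = weighted_ip u x + weighted_ip v x"
    using weighted_ip_integrable[of u x] weighted_ip_integrable[of v x]
    by (simp add: weighted_ip_def plus_bcontfun.rep_eq inner_add_left distrib_left add_divide_distrib)
  show "weighted_ip (r *\<^sub>R u) x = r * weighted_ip u x"
    by (simp add: weighted_ip_def scaleR_bcontfun.rep_eq mult.left_commute[of _ r])
  show "weighted_ip u v = weighted_ip v u"
    by (simp add: weighted_ip_def inner_commute)
  show "0 \<le> weighted_ip u u"
    using w_pos c_pos by (simp add: weighted_ip_def less_imp_le)
qed

lemma \<Phi>0_nonneg: "0 \<le> \<Phi> 0"
  using semi_inner.nonneg[OF semi_inner_weighted_ip, of "character 0"] by (simp add: weighted_ip_character)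

text \<open>The characters are the features: their pairings give \<open>K\<close>, all of them have
  length \<open>sqrt (\<Phi> 0)\<close>, and continuity of the pairings is that of \<Phi>.\<close>

lemma rkhs_exists: "\<exists>H ip. is_rkhs K H ip"
proof -
  interpret semi_inner weighted_ip by (rule semi_inner_weighted_ip)
  interpret feature_map weighted_ip character "sqrt (\<Phi> 0)"
  proof
    show "N (character x) \<le> sqrt (\<Phi> 0)" for x
      by (simp add: N_def weighted_ip_character)
    show "continuous_on UNIV (\<lambda>x. weighted_ip (character y) (character x))" for y
      unfolding weighted_ip_character
      by (intro continuous_on_compose2[OF continuous_\<Phi>] continuous_intros) auto
  qed
  show ?thesis
    using is_rkhs_feature_space[of K] by (auto simp: K_eq weighted_ip_character)
qed

sublocale bounded_rkhs K "\<Phi> 0"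
  by standard (use rkhs_exists in \<open>auto simp: K_eq\<close>)

text \<open>Testing the discrepancy against the kernel sections \<open>K(\<cdot>, y)\<close> bounds the potential \<open>u\<close> of
  \<open>\<mu> - \<nu>\<close> uniformly; integrating \<open>u\<close> against \<open>\<mu> - \<nu>\<close> gives the energy in Fourier space.\<close>

lemma mmd_controls_cf:
  assumes \<mu>: "\<mu> \<in> borel_probs" and \<nu>: "\<nu> \<in> borel_probs"
  shows "(\<integral>\<xi>. w \<xi> * (norm (cf \<mu> \<xi> - cf \<nu> \<xi>))\<^sup>2 \<partial>lborel) \<le> 2 * c * sqrt (\<Phi> 0) * mmd K \<mu> \<nu>"
proof -
  define h where "h \<xi> = cf \<mu> \<xi> - cf \<nu> \<xi>" for \<xi>
  define u where "u y = (\<integral>x. K x y \<partial>\<mu>) - (\<integral>x. K x y \<partial>\<nu>)" for y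
  have cf_m[measurable]: "cf \<mu> \<in> borel_measurable borel" "cf \<nu> \<in> borel_measurable borel"
    using \<mu> \<nu> by (simp_all add: borel_measurable_cf)
  have wc: "integrable lborel (\<lambda>\<xi>. complex_of_real (w \<xi>))"
    using w_int by (simp add: complex_of_real_integrable_eq)
  have h_le: "norm (h \<xi>) \<le> 2" for \<xi>
    using norm_triangle_ineq4[of "cf \<mu> \<xi>" "cf \<nu> \<xi>"] norm_cf_le[OF \<mu>, of \<xi>] norm_cf_le[OF \<nu>, of \<xi>]
    by (simp add: h_def)
  have h_m[measurable]: "h \<in> borel_measurable borel" unfolding h_def by measurable
  have wh: "integrable lborel (\<lambda>\<xi>. complex_of_real (w \<xi>) * h \<xi>)"
    using wc h_le by (intro integrable_mult_bounded[where C = 2]) auto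
  have sections: "complex_of_real (\<integral>x. K x y \<partial>\<rho>) =
      (\<integral>\<xi>. complex_of_real (w \<xi>) * cf \<rho> \<xi> * cis (\<xi> \<bullet> (- y)) \<partial>lborel) / complex_of_real c"
    if \<rho>: "\<rho> \<in> borel_probs" for \<rho> y
  proof -
    have "complex_of_real (\<integral>x. K x y \<partial>\<rho>) =
        (\<integral>x. (\<integral>\<xi>. complex_of_real (w \<xi>) * cis (\<xi> \<bullet> (x - y)) \<partial>lborel) \<partial>\<rho>) / complex_of_real c"
      by (simp only: integral_complex_of_real[symmetric] K_eq \<Phi>_fourier integral_divide_zero)
    also have "(\<integral>x. (\<integral>\<xi>. complex_of_real (w \<xi>) * cis (\<xi> \<bullet> (x - y)) \<partial>lborel) \<partial>\<rho>) =
        (\<integral>\<xi>. complex_of_real (w \<xi>) * (\<integral>x. cis (\<xi> \<bullet> (x - y)) \<partial>\<rho>) \<partial>lborel)"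
      by (rule cf_Fubini[OF \<rho> wc]) measurable
    also have "(\<lambda>\<xi>. \<integral>x. cis (\<xi> \<bullet> (x - y)) \<partial>\<rho>) = (\<lambda>\<xi>. cf \<rho> \<xi> * cis (\<xi> \<bullet> (- y)))"
      by (simp add: cf_def inner_diff_right cis_mult flip: integral_mult_left_zero)
    finally show ?thesis by (simp add: mult.assoc)
  qed
  have u_fourier: "complex_of_real (u y) =
      (\<integral>\<xi>. complex_of_real (w \<xi>) * h \<xi> * cis (\<xi> \<bullet> (- y)) \<partial>lborel) / complex_of_real c" for y
  proof -
    have i: "integrable lborel (\<lambda>\<xi>. complex_of_real (w \<xi>) * cf \<rho> \<xi> * cis (\<xi> \<bullet> (- y)))" if \<rho>: "\<rho> \<in> borel_probs" for \<rho>
    proof (rule integrable_mult_bounded[where C = 1])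
      show "integrable lborel (\<lambda>\<xi>. complex_of_real (w \<xi>) * cf \<rho> \<xi>)"
        using wc norm_cf_le[OF \<rho>] borel_measurable_cf[OF \<rho>]
        by (intro integrable_mult_bounded[where C = 1]) auto
    qed auto
    have "complex_of_real (u y) = ((\<integral>\<xi>. complex_of_real (w \<xi>) * cf \<mu> \<xi> * cis (\<xi> \<bullet> (- y)) \<partial>lborel) -
        (\<integral>\<xi>. complex_of_real (w \<xi>) * cf \<nu> \<xi> * cis (\<xi> \<bullet> (- y)) \<partial>lborel)) / complex_of_real c"
      by (simp only: u_def of_real_diff sections[OF \<mu>] sections[OF \<nu>] diff_divide_distrib)
    also have "(\<integral>\<xi>. complex_of_real (w \<xi>) * cf \<mu> \<xi> * cis (\<xi> \<bullet> (- y)) \<partial>lborel) -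
        (\<integral>\<xi>. complex_of_real (w \<xi>) * cf \<nu> \<xi> * cis (\<xi> \<bullet> (- y)) \<partial>lborel) =
      (\<integral>\<xi>. complex_of_real (w \<xi>) * cf \<mu> \<xi> * cis (\<xi> \<bullet> (- y)) -
        complex_of_real (w \<xi>) * cf \<nu> \<xi> * cis (\<xi> \<bullet> (- y)) \<partial>lborel)"
      by (rule Bochner_Integration.integral_diff[symmetric, OF i[OF \<mu>] i[OF \<nu>]])
    finally show ?thesis by (simp only: h_def left_diff_distrib right_diff_distrib)
  qed
  have u_le: "\<bar>u y\<bar> \<le> sqrt (\<Phi> 0) * mmd K \<mu> \<nu>" for y
    unfolding u_def by (rule mmd_kernel[OF \<mu> \<nu>])
  have u_m: "u \<in> borel_measurable borel"
  proof -
    have "(\<lambda>y. Re (complex_of_real (u y))) \<in> borel_measurable borel"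
      unfolding u_fourier by measurable
    then show ?thesis by simp
  qed
  have u_int: "complex_of_real (\<integral>y. u y \<partial>\<rho>) =
      (\<integral>\<xi>. complex_of_real (w \<xi>) * h \<xi> * cnj (cf \<rho> \<xi>) \<partial>lborel) / complex_of_real c"
    if \<rho>: "\<rho> \<in> borel_probs" for \<rho>
  proof -
    have "complex_of_real (\<integral>y. u y \<partial>\<rho>) =
        (\<integral>y. (\<integral>\<xi>. complex_of_real (w \<xi>) * h \<xi> * cis (\<xi> \<bullet> (- y)) \<partial>lborel) \<partial>\<rho>) / complex_of_real c"
      by (simp only: integral_complex_of_real[symmetric] u_fourier integral_divide_zero)
    also have "(\<integral>y. (\<integral>\<xi>. complex_of_real (w \<xi>) * h \<xi> * cis (\<xi> \<bullet> (- y)) \<partial>lborel) \<partial>\<rho>) =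
        (\<integral>\<xi>. complex_of_real (w \<xi>) * h \<xi> * (\<integral>y. cis (\<xi> \<bullet> (- y)) \<partial>\<rho>) \<partial>lborel)"
      by (rule cf_Fubini[OF \<rho> wh]) measurable
    finally show ?thesis by (simp only: cnj_cf)
  qed
  have i: "integrable lborel (\<lambda>\<xi>. complex_of_real (w \<xi>) * h \<xi> * cnj (cf \<rho> \<xi>))" if \<rho>: "\<rho> \<in> borel_probs" for \<rho>
    by (rule integrable_mult_bounded[OF wh, where C = 1])
      (simp_all add: borel_measurable_cnj_cf \<rho> norm_cf_le)
  have "complex_of_real (c * ((\<integral>y. u y \<partial>\<mu>) - (\<integral>y. u y \<partial>\<nu>))) =
      (\<integral>\<xi>. complex_of_real (w \<xi>) * h \<xi> * cnj (cf \<mu> \<xi>) \<partial>lborel) -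
      (\<integral>\<xi>. complex_of_real (w \<xi>) * h \<xi> * cnj (cf \<nu> \<xi>) \<partial>lborel)"
    using c_pos by (simp add: u_int[OF \<mu>] u_int[OF \<nu>] right_diff_distrib)
  also have "\<dots> = (\<integral>\<xi>. complex_of_real (w \<xi>) * h \<xi> * cnj (cf \<mu> \<xi>) -
      complex_of_real (w \<xi>) * h \<xi> * cnj (cf \<nu> \<xi>) \<partial>lborel)"
    by (rule Bochner_Integration.integral_diff[symmetric, OF i[OF \<mu>] i[OF \<nu>]])
  also have "\<dots> = (\<integral>\<xi>. complex_of_real (w \<xi> * (norm (h \<xi>))\<^sup>2) \<partial>lborel)"
    by (simp only: right_diff_distrib[symmetric] complex_cnj_diff[symmetric] h_def[symmetric] of_real_mult
        complex_norm_square mult.assoc)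
  also have "\<dots> = complex_of_real (\<integral>\<xi>. w \<xi> * (norm (h \<xi>))\<^sup>2 \<partial>lborel)"
    by (rule integral_complex_of_real)
  finally have "(\<integral>\<xi>. w \<xi> * (norm (h \<xi>))\<^sup>2 \<partial>lborel) = c * ((\<integral>y. u y \<partial>\<mu>) - (\<integral>y. u y \<partial>\<nu>))"
    using of_real_eq_iff by metis
  also have "\<dots> \<le> c * (2 * (sqrt (\<Phi> 0) * mmd K \<mu> \<nu>))"
  proof (rule mult_left_mono)
    have "\<bar>\<integral>y. u y \<partial>\<rho>\<bar> \<le> sqrt (\<Phi> 0) * mmd K \<mu> \<nu>" if "\<rho> \<in> borel_probs" for \<rho>
      using borel_probs_integral_bound[OF that u_m] u_le by simp
    from this[OF \<mu>] this[OF \<nu>]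
    show "(\<integral>y. u y \<partial>\<mu>) - (\<integral>y. u y \<partial>\<nu>) \<le> 2 * (sqrt (\<Phi> 0) * mmd K \<mu> \<nu>)" by linarith
  qed (use c_pos in simp)
  finally show ?thesis by (simp add: h_def mult_ac)
qed

text \<open>For compactly supported \<open>f\<close> the error has three parts of size at most
  \<open>e / 4\<close>: replacing \<open>f\<close> by the Fourier integral \<open>F\<close> under
  each measure, and the change of the integral of \<open>F\<close>, which the energy controls.
  \<open>vague_imp_weak\<close> then removes the support condition.\<close>

lemma mmd_small_imp_integral_close:
  fixes f :: "'a \<Rightarrow> real"
  assumes \<mu>: "\<mu> \<in> borel_probs" and f: "continuous_on UNIV f" "bounded (range f)" and "e > 0"
  shows "\<exists>\<delta>>0. \<forall>\<nu>\<in>borel_probs. mmd K \<mu> \<nu> < \<delta> \<longrightarrow> \<bar>(\<integral>x. f x \<partial>\<nu>) - (\<integral>x. f x \<partial>\<mu>)\<bar> < e"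
proof (rule vague_imp_weak[OF \<mu> _ f \<open>e > 0\<close>])
  fix f :: "'a \<Rightarrow> real" and R e :: real
  assume f: "continuous_on UNIV f" and supp: "\<And>x. x \<notin> cball 0 R \<Longrightarrow> f x = 0" and "e > 0"
  then have e4: "e / 4 > 0" by simp
  obtain g :: "'a \<Rightarrow> complex" where g_close: "integrable lborel g \<and>
      (\<forall>x. \<bar>f x - Re (\<integral>\<xi>. g \<xi> * cis (\<xi> \<bullet> x) \<partial>lborel)\<bar> \<le> e / 4)"
    using compact_support_uniform_approx_fourier[OF f supp e4] ..
  then have g: "integrable lborel g" ..
  define F where "F x = Re (\<integral>\<xi>. g \<xi> * cis (\<xi> \<bullet> x) \<partial>lborel)" for x
  have close: "\<bar>f x - F x\<bar> \<le> e / 4" for x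
    using g_close by (simp only: F_def)
  \<comment> \<open>The bound 2 suits the difference of two characteristic functions.\<close>
  obtain \<delta> where \<delta>: "\<delta> > 0" "\<forall>h\<in>borel_measurable lborel. (\<forall>x. 0 \<le> h x \<and> h x \<le> 2) \<longrightarrow>
      (\<integral>x. w x * (h x)\<^sup>2 \<partial>lborel) \<le> \<delta> \<longrightarrow> (\<integral>x. norm (g x) * h x \<partial>lborel) \<le> e / 4"
    using weighted_L2_small_imp_L1_small[OF w_int w_pos integrable_norm[OF g] norm_ge_zero e4, of 2] by auto
  \<comment> \<open>The summand 1 makes \<open>L\<close> positive from
    \<open>0 \<le> \<Phi> 0\<close> alone, so that \<open>\<delta> / L\<close> is a valid
    threshold.\<close>
  define L where "L = 2 * c * sqrt (\<Phi> 0) + 1"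
  have L: "L > 0" using c_pos \<Phi>0_nonneg by (simp add: L_def add_nonneg_pos)
  have fm: "f \<in> borel_measurable borel" using f by (rule borel_measurable_continuous_onI)
  have "bounded (f ` cball 0 R)"
    by (intro compact_imp_bounded compact_continuous_image continuous_on_subset[OF f]) auto
  then obtain M where "\<forall>y\<in>f ` cball 0 R. norm y \<le> M"
    unfolding bounded_iff by blast
  then have M: "\<bar>f x\<bar> \<le> M" if "x \<in> cball 0 R" for x
    using that by auto
  have M': "norm (f x) \<le> \<bar>M\<bar>" for x
    using M[of x] supp[of x] by (cases "x \<in> cball 0 R") auto
  have fF: "\<bar>(\<integral>x. f x \<partial>\<rho>) - (\<integral>x. F x \<partial>\<rho>)\<bar> \<le> e / 4" if \<rho>: "\<rho> \<in> borel_probs" for \<rho>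
  proof -
    interpret P: prob_space \<rho> using \<rho> by (rule borel_probs_prob_space)
    have fi: "integrable \<rho> f" by (rule borel_probs_integrable[OF \<rho> fm M'])
    have Fi: "integrable \<rho> F" unfolding F_def by (rule fourier_integral_diff_bound(1)[OF \<rho> \<rho> g])
    have "(\<integral>x. f x \<partial>\<rho>) - (\<integral>x. F x \<partial>\<rho>) = (\<integral>x. f x - F x \<partial>\<rho>)" using fi Fi by simp
    then have "\<bar>(\<integral>x. f x \<partial>\<rho>) - (\<integral>x. F x \<partial>\<rho>)\<bar> \<le> (\<integral>x. \<bar>f x - F x\<bar> \<partial>\<rho>)"
      by (simp only: integral_abs_bound)
    also have "\<dots> \<le> (\<integral>x. e / 4 \<partial>\<rho>)"
      using fi Fi close by (intro integral_mono) auto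
    finally show ?thesis using P.prob_space by simp
  qed
  have "\<bar>(\<integral>x. f x \<partial>\<nu>) - (\<integral>x. f x \<partial>\<mu>)\<bar> < e" if \<nu>: "\<nu> \<in> borel_probs" and small: "mmd K \<mu> \<nu> < \<delta> / L" for \<nu>
  proof -
    have "(\<integral>\<xi>. w \<xi> * (norm (cf \<mu> \<xi> - cf \<nu> \<xi>))\<^sup>2 \<partial>lborel) \<le> 2 * c * sqrt (\<Phi> 0) * mmd K \<mu> \<nu>"
      by (rule mmd_controls_cf[OF \<mu> \<nu>])
    also have "\<dots> \<le> L * mmd K \<mu> \<nu>"
      using mmd_nonneg by (intro mult_right_mono) (auto simp: L_def)
    also have "\<dots> \<le> \<delta>" using small L by (simp add: field_simps)
    finally have "(\<integral>\<xi>. w \<xi> * (norm (cf \<mu> \<xi> - cf \<nu> \<xi>))\<^sup>2 \<partial>lborel) \<le> \<delta>" .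
    moreover have "(\<lambda>\<xi>. norm (cf \<mu> \<xi> - cf \<nu> \<xi>)) \<in> borel_measurable lborel"
      using borel_measurable_cf[OF \<mu>] borel_measurable_cf[OF \<nu>] by simp
    moreover have "norm (cf \<mu> \<xi> - cf \<nu> \<xi>) \<le> 2" for \<xi>
      using norm_triangle_ineq4[of "cf \<mu> \<xi>" "cf \<nu> \<xi>"] norm_cf_le[OF \<mu>, of \<xi>] norm_cf_le[OF \<nu>, of \<xi>]
      by simp
    ultimately have "(\<integral>\<xi>. norm (g \<xi>) * norm (cf \<mu> \<xi> - cf \<nu> \<xi>) \<partial>lborel) \<le> e / 4"
      using \<delta>(2)[rule_format, of "\<lambda>\<xi>. norm (cf \<mu> \<xi> - cf \<nu> \<xi>)"] by simp
    then have "\<bar>(\<integral>x. F x \<partial>\<nu>) - (\<integral>x. F x \<partial>\<mu>)\<bar> \<le> e / 4"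
      using fourier_integral_diff_bound(2)[OF \<mu> \<nu> g] by (simp add: F_def)
    then show ?thesis using fF[OF \<mu>] fF[OF \<nu>] \<open>e > 0\<close> by linarith
  qed
  then show "\<exists>\<delta>>0. \<forall>\<nu>\<in>borel_probs. mmd K \<mu> \<nu> < \<delta> \<longrightarrow> \<bar>(\<integral>x. f x \<partial>\<nu>) - (\<integral>x. f x \<partial>\<mu>)\<bar> < e"
    using \<delta>(1) L by (intro exI[of _ "\<delta> / L"]) auto
qed

lemma mmd_eq_0_imp_eq:
  assumes \<mu>: "\<mu> \<in> borel_probs" and \<nu>: "\<nu> \<in> borel_probs" and "mmd K \<mu> \<nu> = 0"
  shows "\<mu> = \<nu>"
proof (rule borel_probs_eqI[OF \<mu> \<nu>])
  fix f :: "'a \<Rightarrow> real" assume f: "continuous_on UNIV f" "bounded (range f)"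
  have "\<bar>(\<integral>x. f x \<partial>\<nu>) - (\<integral>x. f x \<partial>\<mu>)\<bar> < e" if "e > 0" for e
    using mmd_small_imp_integral_close[OF \<mu> f that] \<nu> assms(3) by auto
  then have "\<not> \<bar>(\<integral>x. f x \<partial>\<nu>) - (\<integral>x. f x \<partial>\<mu>)\<bar> > 0" by blast
  then show "(\<integral>x. f x \<partial>\<mu>) = (\<integral>x. f x \<partial>\<nu>)" by simp
qed

lemma Metric_space_mmd: "Metric_space borel_probs (mmd K)"
proof
  show "0 \<le> mmd K \<mu> \<nu>" for \<mu> \<nu> by (rule mmd_nonneg)
  show "mmd K \<mu> \<nu> = mmd K \<nu> \<mu>" for \<mu> \<nu> by (rule mmd_commute)
  show "mmd K \<mu> \<nu> = 0 \<longleftrightarrow> \<mu> = \<nu>" if "\<mu> \<in> borel_probs" "\<nu> \<in> borel_probs" for \<mu> \<nu>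
    using mmd_eq_0_imp_eq[OF that] mmd_self by blast
  show "mmd K \<mu> \<rho> \<le> mmd K \<mu> \<nu> + mmd K \<nu> \<rho>"
    if "\<mu> \<in> borel_probs" "\<nu> \<in> borel_probs" "\<rho> \<in> borel_probs" for \<mu> \<nu> \<rho>
    using that by (rule mmd_triangle)
qed

text \<open>The squared distance of two kernel sections is
  \<open>2 * (\<Phi> 0 - \<Phi> (x - y))\<close>. It depends on \<open>x - y\<close> alone, so
  continuity of \<Phi> at 0 already gives an estimate uniform in the points and in the unit ball;
  half of \<open>e\<^sup>2\<close> absorbs the factor 2.\<close>

lemma unit_ball_equicontinuous:
  assumes "e > 0"
  shows "\<exists>r>0. \<forall>f\<in>unit_ball. \<forall>x y. dist x y < r \<longrightarrow> \<bar>f x - f y\<bar> \<le> e"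
proof -
  have "isCont \<Phi> 0" using continuous_\<Phi> by (simp add: continuous_on_eq_continuous_at)
  moreover have "e\<^sup>2 / 2 > 0" using assms by simp
  ultimately obtain r where r: "r > 0" "\<And>z. dist z 0 < r \<Longrightarrow> \<bar>\<Phi> z - \<Phi> 0\<bar> < e\<^sup>2 / 2"
    unfolding continuous_at_eps_delta dist_real_def by blast
  have "\<bar>f x - f y\<bar> \<le> e" if f: "f \<in> unit_ball" and "dist x y < r" for f x y
  proof -
    have "\<bar>\<Phi> (x - y) - \<Phi> 0\<bar> < e\<^sup>2 / 2" using r(2)[of "x - y"] that(2) by (simp add: dist_norm)
    moreover have "K x x - K x y - K y x + K y y = 2 * (\<Phi> 0 - \<Phi> (x - y))"
      using \<Phi>_uminus[of "x - y"] by (simp add: K_eq)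
    ultimately have "\<bar>K x x - K x y - K y x + K y y\<bar> \<le> e\<^sup>2" 
      by (simp only: abs_mult abs_minus_commute[of "\<Phi> 0"]) simp
    then have "sqrt \<bar>K x x - K x y - K y x + K y y\<bar> \<le> e"
      using assms by (intro real_le_lsqrt) auto
    with unit_ball_diff_bound[OF f, of x y] show ?thesis by simp
  qed
  with r(1) show ?thesis by blast
qed

section \<open>Comparison of the metric and the weak topology\<close>

lemma openin_weak_basic:
  fixes g :: "'a \<Rightarrow> real"
  assumes "continuous_on UNIV g" "bounded (range g)" "open U"
  shows "openin weak_topology {\<nu> \<in> borel_probs. (\<integral>x. g x \<partial>\<nu>) \<in> U}"
  unfolding weak_topology_def
  by (rule topology_generated_by_Basis, rule CollectI, rule exI[of _ g], rule exI[of _ U]) (simp add: assms)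

lemma weak_neighbourhood_in_mball:
  assumes \<mu>: "\<mu> \<in> borel_probs" and "r > 0"
  shows "\<exists>W. openin weak_topology W \<and> \<mu> \<in> W \<and> W \<subseteq> Metric_space.mball borel_probs (mmd K) \<mu> r"
proof -
  interpret Metric_space borel_probs "mmd K" by (rule Metric_space_mmd)
  \<comment> \<open>Uniform integral bounds yield a non-strict bound on the supremum, whereas the
    ball is strict; halving the radius closes the gap.\<close>
  have "r / 2 > 0" using \<open>r > 0\<close> by simp
  have "\<exists>(G :: ('a \<Rightarrow> real) set) \<delta>. finite G \<and> \<delta> > 0 \<and> (\<forall>g\<in>G. continuous_on UNIV g \<and> bounded (range g)) \<and>
    (\<forall>\<nu>\<in>borel_probs. (\<forall>g\<in>G. \<bar>(\<integral>x. g x \<partial>\<nu>) - (\<integral>x. g x \<partial>\<mu>)\<bar> < \<delta>) \<longrightarrow>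
      (\<forall>f\<in>unit_ball. \<bar>(\<integral>x. f x \<partial>\<nu>) - (\<integral>x. f x \<partial>\<mu>)\<bar> \<le> r / 2))"
    by (rule weak_neighbourhood_equicontinuous[OF \<mu> \<open>r / 2 > 0\<close>])
      (rule unit_ball_continuous unit_ball_bound unit_ball_equicontinuous; assumption)+
  then obtain G :: "('a \<Rightarrow> real) set" and \<delta> where G: "finite G" "\<delta> > 0"
    "\<forall>g\<in>G. continuous_on UNIV g \<and> bounded (range g)"
    and close: "\<forall>\<nu>\<in>borel_probs. (\<forall>g\<in>G. \<bar>(\<integral>x. g x \<partial>\<nu>) - (\<integral>x. g x \<partial>\<mu>)\<bar> < \<delta>) \<longrightarrow>
      (\<forall>f\<in>unit_ball. \<bar>(\<integral>x. f x \<partial>\<nu>) - (\<integral>x. f x \<partial>\<mu>)\<bar> \<le> r / 2)"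
    by (elim exE conjE) (rule that; assumption)
  define V where "V g = {\<nu> \<in> borel_probs. (\<integral>x. g x \<partial>\<nu>) \<in> ball (\<integral>x. g x \<partial>\<mu>) \<delta>}" for g :: "'a \<Rightarrow> real"
  \<comment> \<open>With \<open>borel_probs\<close> as a member, the intersection stays a set of
    probability measures even for empty \<open>G\<close>. Its own openness comes from the zero
    function and the open set \<open>UNIV\<close>.\<close>
  define W where "W = \<Inter> (insert borel_probs (V ` G))"
  have "openin weak_topology {\<nu> \<in> borel_probs. (\<integral>x. (0::real) \<partial>(\<nu> :: 'a measure)) \<in> UNIV}"
    by (rule openin_weak_basic) auto
  then have "openin weak_topology (borel_probs :: 'a measure set)" by simp
  moreover have "openin weak_topology (V g)" if "g \<in> G" for g
    unfolding V_def using bspec[OF G(3) that] by (intro openin_weak_basic) auto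
  ultimately have "openin weak_topology W"
    unfolding W_def using G(1) by (intro openin_Inter) auto
  moreover have "\<mu> \<in> W" using \<mu> G(2) by (auto simp: W_def V_def)
  moreover have "W \<subseteq> mball \<mu> r"
  proof
    fix \<nu> assume "\<nu> \<in> W"
    then have \<nu>: "\<nu> \<in> borel_probs" and "\<forall>g\<in>G. \<bar>(\<integral>x. g x \<partial>\<nu>) - (\<integral>x. g x \<partial>\<mu>)\<bar> < \<delta>"
      by (auto simp: W_def V_def dist_real_def abs_minus_commute)
    then have "mmd K \<nu> \<mu> \<le> r / 2"
      using close \<open>r > 0\<close> by (intro mmd_least) auto
    then show "\<nu> \<in> mball \<mu> r"
      using \<mu> \<nu> \<open>r > 0\<close> mmd_commute[of \<mu> \<nu>] by simp
  qed
  ultimately show ?thesis by blast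
qed

text \<open>One inclusion is local, by weak neighbourhoods inside balls. For the other, the
  generated topology is the coarsest one containing its generators, so it suffices that each
  generating set is open for the metric.\<close>

theorem mtopology_mmd_eq_weak_topology:
  "Metric_space.mtopology borel_probs (mmd K) = weak_topology"
proof -
  interpret Metric_space borel_probs "mmd K" by (rule Metric_space_mmd)
  have "openin weak_topology U" if U: "openin mtopology U" for U
  proof (subst openin_subopen, intro ballI)
    fix \<mu> assume "\<mu> \<in> U"
    then obtain r where r: "\<mu> \<in> borel_probs" "r > 0" "mball \<mu> r \<subseteq> U"
      using U unfolding openin_mtopology by blast
    show "\<exists>T. openin weak_topology T \<and> \<mu> \<in> T \<and> T \<subseteq> U"
      using weak_neighbourhood_in_mball[OF r(1,2)] r(3) by blast
  qed
  moreover have "openin mtopology U" if U: "openin weak_topology U" for U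
  proof (rule generate_topology_on_coarsest[OF istopology_openin _
        openin_topology_generated_by[OF U[unfolded weak_topology_def]]])
    fix S :: "'a measure set"
    assume "S \<in> {{\<mu> \<in> borel_probs. (\<integral>x. f x \<partial>\<mu>) \<in> U} | (f :: 'a \<Rightarrow> real) U.
        continuous_on UNIV f \<and> bounded (range f) \<and> open U}"
    then obtain f :: "'a \<Rightarrow> real" and V where S: "S = {\<mu> \<in> borel_probs. (\<integral>x. f x \<partial>\<mu>) \<in> V}"
      and f: "continuous_on UNIV f" "bounded (range f)" and V: "open V" by blast
    show "openin mtopology S"
      unfolding openin_mtopology
    proof (intro conjI allI impI)
      show "S \<subseteq> borel_probs" by (auto simp: S)
      fix \<mu> assume "\<mu> \<in> S"
      then have \<mu>: "\<mu> \<in> borel_probs" "(\<integral>x. f x \<partial>\<mu>) \<in> V" by (auto simp: S)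
      then obtain e where e: "e > 0" "ball (\<integral>x. f x \<partial>\<mu>) e \<subseteq> V" using V open_contains_ball by blast
      obtain \<delta> where \<delta>: "\<delta> > 0"
        "\<And>\<nu>. \<nu> \<in> borel_probs \<Longrightarrow> mmd K \<mu> \<nu> < \<delta> \<Longrightarrow> \<bar>(\<integral>x. f x \<partial>\<nu>) - (\<integral>x. f x \<partial>\<mu>)\<bar> < e"
        using mmd_small_imp_integral_close[OF \<mu>(1) f e(1)] by blast
      have "mball \<mu> \<delta> \<subseteq> S"
      proof
        fix \<nu> assume "\<nu> \<in> mball \<mu> \<delta>"
        then have \<nu>: "\<nu> \<in> borel_probs" "mmd K \<mu> \<nu> < \<delta>" by auto
        then have "(\<integral>x. f x \<partial>\<nu>) \<in> ball (\<integral>x. f x \<partial>\<mu>) e"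
          using \<delta>(2)[OF \<nu>] by (simp add: dist_real_def abs_minus_commute)
        then show "\<nu> \<in> S" using e(2) \<nu>(1) by (auto simp: S)
      qed
      with \<delta>(1) show "\<exists>r>0. mball \<mu> r \<subseteq> S" by blast
    qed
  qed
  ultimately show ?thesis unfolding topology_eq by blast
qed

end

section \<open>Matching the normalisation of the Fourier transform\<close>

theorem proposition2p1:
  fixes K :: "real ^ 'd \<Rightarrow> real ^ 'd \<Rightarrow> real"
    and \<Phi> :: "real ^ 'd \<Rightarrow> real"
  assumes "C1_b (\<lambda>(x, y). K x y)"
    and "symmetric_kernel K"
    and "strictly_positive_definite K"
    and "\<And>x y. K x y = \<Phi> (x - y)"
    and "continuous_on UNIV \<Phi>"
    and "integrable lborel \<Phi>"
    and "integrable lborel (fourier (\<lambda>x. complex_of_real (\<Phi> x)))"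
    and "\<And>\<xi>. fourier (\<lambda>x. complex_of_real (\<Phi> x)) \<xi> \<in> \<real> \<and>
               Re (fourier (\<lambda>x. complex_of_real (\<Phi> x)) \<xi>) > 0"
  shows "Metric_space borel_probs (mmd K) \<and>
         Metric_space.mtopology borel_probs (mmd K) = weak_topology"
proof -
  \<comment> \<open>\<open>1 / c\<close> is the factor in \<open>fourier\<close>. The unnormalised
    transform \<open>\<Phi>hat\<close> is \<open>c\<close> times \<open>w\<close>, and inversion
    divides by \<open>c * c\<close>, which leaves the single division by \<open>c\<close> of the
    locale.\<close>
  define c where "c = (2 * pi) powr (real DIM(real ^ 'd) / 2)"
  have c: "c > 0" by (simp add: c_def)
  have "c * c = (2 * pi) powr real DIM(real ^ 'd)"
    by (simp add: c_def flip: powr_add)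
  then have cc: "c * c = (2 * pi) ^ DIM(real ^ 'd)"
    by (simp add: powr_realpow)
  define \<Phi>hat where "\<Phi>hat \<xi> = (\<integral>y. complex_of_real (\<Phi> y) * cis (- (\<xi> \<bullet> y)) \<partial>lborel)" for \<xi>
  define w where "w \<xi> = Re (fourier (\<lambda>x. complex_of_real (\<Phi> x)) \<xi>)" for \<xi>
  have w: "fourier (\<lambda>x. complex_of_real (\<Phi> x)) \<xi> = complex_of_real (w \<xi>)" for \<xi>
    using assms(8)[of \<xi>] by (auto simp: w_def Reals_def)
  have \<Phi>hat: "\<Phi>hat \<xi> = complex_of_real c * complex_of_real (w \<xi>)" for \<xi>
  proof -
    have "complex_of_real (w \<xi>) = complex_of_real (inverse c) * \<Phi>hat \<xi>"
      unfolding w[symmetric] fourier_def \<Phi>hat_def c_def by (simp add: cis_conv_exp powr_minus)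
    then show ?thesis using c by simp
  qed
  have "integrable lborel (\<lambda>\<xi>. complex_of_real (w \<xi>))"
    using assms(7) by (simp add: w[abs_def])
  then have w_int: "integrable lborel w" by (simp add: complex_of_real_integrable_eq)
  \<comment> \<open>Inversion asks for a bounded \<Phi>; the bound is inherited from
    \<open>K\<close> by setting \<open>y = 0\<close>.\<close>
  obtain M where bound: "\<And>z. \<bar>(\<lambda>(x, y). K x y) z\<bar> \<le> M"
    using assms(1) unfolding C1_b_def bounded_iff by auto
  have M: "\<bar>\<Phi> x\<bar> \<le> M" for x using bound[of "(x, 0)"] by (simp add: assms(4))
  have \<Phi>: "complex_of_real (\<Phi> x) =
      (\<integral>\<xi>. complex_of_real (w \<xi>) * cis (\<xi> \<bullet> x) \<partial>lborel) / complex_of_real c" for x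
  proof -
    have "integrable lborel \<Phi>hat"
      unfolding \<Phi>hat using w_int by (simp add: complex_of_real_integrable_eq)
    then have "complex_of_real (\<Phi> x) =
        (\<integral>\<xi>. \<Phi>hat \<xi> * cis (\<xi> \<bullet> x) \<partial>lborel) / complex_of_real ((2 * pi) ^ DIM(real ^ 'd))"
      unfolding \<Phi>hat_def[abs_def] by (intro fourier_inversion[where M = M] assms(5,6) M)
    also have "\<dots> = complex_of_real c * (\<integral>\<xi>. complex_of_real (w \<xi>) * cis (\<xi> \<bullet> x) \<partial>lborel) /
        (complex_of_real c * complex_of_real c)"
      unfolding \<Phi>hat mult.assoc integral_mult_right_zero cc[symmetric] of_real_mult ..
    finally show ?thesis using c by simp
  qed
  interpret fourier_kernel K \<Phi> w c
  proof
    show "w \<xi> > 0" for \<xi> using assms(8)[of \<xi>] by (simp only: w_def)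
  qed (fact assms(4,5) w_int c \<Phi>)+
  show ?thesis using Metric_space_mmd mtopology_mmd_eq_weak_topology by blast
qed

end
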